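(* Let $J$ be a spin ($2J$ a nonnegative integer), let $X=\{\mathbf n_k\}_{k=1}^{M}\subset\mathcal S^2$ be a spherical $t$-design, and let $\varrho$ be a density operator on $\mathcal H_J$. Let $k_1,\dots,k_{N_s}$ be independent random outcomes, each distributed on $\{1,\dots,M\}$ according to $p_k=\operatorname{Tr}(\varrho E_k)$ with $E_k=\frac{2J+1}{M}P(\mathbf n_k)$. For $a,b\in\{x,y,z\}$ define $$X_a(k)=(J+1)\,n_{k,a},\qquad Y_{ab}(k)=\frac{(J+1)(2J+3)}{2}\,n_{k,a}n_{k,b}-\frac{J+1}{2}\,\delta_{ab},$$ $$\hat\mu_a=\frac1{N_s}\sum_{i=1}^{N_s}X_a(k_i),\qquad \hat C_{ab}=\frac1{N_s}\sum_{i=1}^{N_s}Y_{ab}(k_i),\qquad \hat q_{ab}=\frac1{N_s}\sum_{i=1}^{N_s}X_a(k_i)X_b(k_i),$$ and, for $N_s>1$, $$\hat\Gamma_{ab}=\hat C_{ab}-\frac{N_s\,\hat\mu_a\hat\mu_b-\hat q_{ab}}{N_s-1}.$$ If $t\ge 2J+2$ and $N_s>1$, then $\mathbb E[\hat\Gamma_{ab}]=\Gamma_{ab}$ for all $a,b\in\{x,y,z\}$, where $$\Gamma_{ab}=\operatorname{Tr}\!\bigl(\varrho\,\tfrac12(J_aJ_b+J_bJ_a)\bigr)-\operatorname{Tr}(\varrho J_a)\operatorname{Tr}(\varrho J_b)$$ is the spin covariance matrix and $\mathbb E$ is the expectation over the outcomes.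
   Context: Spherical designs: $\mathcal S^2\subset\mathbb R^3$ is the unit sphere with rotation-invariant measure $\mathrm d\Omega$ of total mass $4\pi$. A finite set $\{\mathbf n_k\}_{k=1}^M\subset\mathcal S^2$ ($M\ge1$) is a spherical $t$-design if $\frac1M\sum_{k=1}^M f(\mathbf n_k)=\frac1{4\pi}\int_{\mathcal S^2} f(\mathbf n)\,\mathrm d\Omega$ for every spherical polynomial $f$ (restriction to $\mathcal S^2$ of a polynomial in three variables) of degree at most $t$. Spin coherent states: $\mathcal H_J\cong\mathbb C^{2J+1}$ carries the irreducible spin-$J$ representation $U_J$ of $SU(2)$, with angular-momentum operators $J_x,J_y,J_z$ satisfying $[J_x,J_y]=\mathrm iJ_z$ and cyclic permutations ($\hbar=1$), and standard orthonormal basis $|Jm\rangle$, $m=-J,\dots,J$, of $J_z$-eigenvectors. For $\mathbf n\in\mathcal S^2$, $|\mathbf n\rangle_J=U_J(R_{\mathbf n})|JJ\rangle$, where $R_{\mathbf n}$ is a rotation taking the north pole $\mathbf e_z$ to $\mathbf n$ (lifted to $SU(2)$), and $P(\mathbf n)=|\mathbf n\rangle\langle\mathbf n|_J$ is the corresponding rank-one projector, which does not depend on the choice of $R_{\mathbf n}$. The Cartesian components of $\mathbf n_k$ are $n_{k,x},n_{k,y},n_{k,z}$. For a spherical $t$-design with $t\ge 2J$ the operators $E_k$ are positive and sum to the identity, so $(p_k)$ is a probability distribution. *)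

theory Defs
  imports
    "HOL-Probability.Probability"
    "Jordan_Normal_Form.Schur_Decomposition"
begin

no_notation vec_index (infixl "$" 100)

section \<open>Spherical designs\<close>

text \<open>
  The surface measure on the unit sphere of \<open>real ^ 3\<close>: the measure of a Borel set \<open>A\<close> is three times
  the volume of the part of the unit ball that projects radially into \<open>A\<close>. The lemmas
  \<open>emeasure_sphere_measure\<close> and \<open>sphere_measure_rotation_invariant\<close> below show that this is the
  rotation-invariant measure of total mass \<open>4 * pi\<close>.
\<close>

definition sphere_measure :: "(real ^ 3) measure" where
  "sphere_measure =
     scale_measure 3
       (distr (restrict_space lborel (ball 0 1 - {0})) (restrict_space borel (sphere 0 1)) sgn)"

lemma space_sphere_measure [simp]: "space sphere_measure = sphere 0 1"
  by (simp add: sphere_measure_def space_restrict_space space_scale_measure)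

lemma sets_sphere_measure: "sets sphere_measure = sets (restrict_space borel (sphere 0 1))"
  by (simp add: sphere_measure_def)

lemma measurable_radial_projection:
  "sgn \<in> measurable (restrict_space lborel (ball 0 1 - {0 :: real ^ 3}))
                    (restrict_space borel (sphere 0 1))"
  by (rule measurable_restrict_space3) (auto simp: norm_sgn)

lemma emeasure_sphere_measure: "emeasure sphere_measure (sphere 0 1) = ennreal (4 * pi)"
proof -
  let ?B = "ball 0 1 - {0 :: real ^ 3}"
  have vol: "emeasure lborel ?B = ennreal (4 / 3 * pi)"
  proof -
    have "emeasure lborel ?B = emeasure lborel (ball 0 1 :: (real ^ 3) set)"
      by (rule emeasure_Diff_null_set) auto
    also have "\<dots> = ennreal (unit_ball_vol 3)"
      by (simp add: emeasure_ball)
    also have "unit_ball_vol 3 = 4 / 3 * pi"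
      using unit_ball_vol_odd[of 1] by (simp add: fact_numeral)
    finally show ?thesis .
  qed
  have pre: "sgn -` sphere 0 1 \<inter> ?B = ?B"
    by (auto simp: norm_sgn)
  have "emeasure sphere_measure (sphere 0 1) = 3 * emeasure (restrict_space lborel ?B) ?B"
    unfolding sphere_measure_def emeasure_scale_measure
    by (subst emeasure_distr[OF measurable_radial_projection])
       (auto simp: sets_restrict_space space_restrict_space pre simp del: vimage_Int)
  also have "\<dots> = 3 * ennreal (4 / 3 * pi)"
    by (subst emeasure_restrict_space) (auto simp: vol)
  also have "\<dots> = ennreal (4 * pi)"
    using ennreal_mult[of 3 "4 / 3 * pi"] by simp
  finally show ?thesis .
qed

lemma sgn_orthogonal_transformation:
  "orthogonal_transformation f \<Longrightarrow> sgn (f x) = f (sgn x)"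
  by (simp add: sgn_div_norm orthogonal_transformation_norm linear_scale
      orthogonal_transformation_linear)

lemma sphere_measure_rotation_invariant:
  assumes f: "orthogonal_transformation (f :: real ^ 3 \<Rightarrow> real ^ 3)"
  shows "distr sphere_measure sphere_measure f = sphere_measure"
proof (rule measure_eqI)
  let ?B = "ball 0 1 - {0 :: real ^ 3}"
  let ?S = "sphere 0 1 :: (real ^ 3) set"
  have lin: "linear f" using f by (rule orthogonal_transformation_linear)
  have cont: "continuous_on UNIV f" using lin by (simp add: linear_continuous_on linear_linear)
  have fm: "f \<in> borel_measurable borel"
    using cont by (rule borel_measurable_continuous_onI)
  have meas: "f \<in> measurable sphere_measure sphere_measure"
    unfolding measurable_cong_sets[OF sets_sphere_measure sets_sphere_measure]
    by (rule measurable_restrict_space3) (use fm f in \<open>auto simp: orthogonal_transformation_norm\<close>)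
  show "sets (distr sphere_measure sphere_measure f) = sets sphere_measure" by simp
  have val: "emeasure sphere_measure X = 3 * emeasure lborel (sgn -` X \<inter> ?B)"
    if "X \<in> sets sphere_measure" for X
  proof -
    have X: "X \<in> sets (restrict_space borel ?S)" using that sets_sphere_measure by blast
    have "emeasure sphere_measure X
        = 3 * emeasure (restrict_space lborel ?B) (sgn -` X \<inter> ?B)"
      unfolding sphere_measure_def emeasure_scale_measure
      by (subst emeasure_distr[OF measurable_radial_projection X]) (simp add: space_restrict_space)
    also have "emeasure (restrict_space lborel ?B) (sgn -` X \<inter> ?B) = emeasure lborel (sgn -` X \<inter> ?B)"
      by (rule emeasure_restrict_space) auto
    finally show ?thesis .
  qed
  fix A assume "A \<in> sets (distr sphere_measure sphere_measure f)"
  then have A: "A \<in> sets sphere_measure" by simp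
  have fA: "f -` A \<inter> ?S \<in> sets sphere_measure"
    using measurable_sets[OF meas A] by simp
  have borelset: "sgn -` X \<inter> ?B \<in> sets borel" if "X \<in> sets sphere_measure" for X
  proof -
    have "X \<in> sets borel"
      using that by (auto simp: sets_sphere_measure sets_restrict_space)
    then have "sgn -` X \<inter> space borel \<in> sets borel"
      by (rule measurable_sets[OF borel_measurable_sgn])
    then show ?thesis by auto
  qed
  have lm: "sgn -` X \<inter> ?B \<in> lmeasurable" if "X \<in> sets sphere_measure" for X
    by (rule bounded_set_imp_lmeasurable) (use borelset[OF that] in \<open>auto intro: bounded_subset[of "ball 0 1"]\<close>)
  have img: "f ` (sgn -` (f -` A \<inter> ?S) \<inter> ?B) = sgn -` A \<inter> ?B"
  proof (intro equalityI subsetI)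
    fix y assume "y \<in> f ` (sgn -` (f -` A \<inter> ?S) \<inter> ?B)"
    then show "y \<in> sgn -` A \<inter> ?B"
      using f orthogonal_transformation_inj[OF f] linear_0[OF lin]
      by (auto simp: sgn_orthogonal_transformation orthogonal_transformation_norm inj_def)
  next
    fix y assume y: "y \<in> sgn -` A \<inter> ?B"
    obtain x where x: "y = f x" using orthogonal_transformation_surj[OF f] by (metis surjD)
    have "norm x = norm y" using x f by (simp add: orthogonal_transformation_norm)
    then have "x \<in> sgn -` (f -` A \<inter> ?S) \<inter> ?B"
      using y x f linear_0[OF lin] by (auto simp: sgn_orthogonal_transformation norm_sgn)
    then show "y \<in> f ` (sgn -` (f -` A \<inter> ?S) \<inter> ?B)" using x by blast
  qed
  have "emeasure lborel (sgn -` X \<inter> ?B) = ennreal (measure lebesgue (sgn -` X \<inter> ?B))"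
    if "X \<in> sets sphere_measure" for X
    using emeasure_eq_measure2[OF lm[OF that]] borelset[OF that] by simp
  from this[OF fA] this[OF A]
  have "emeasure lborel (sgn -` (f -` A \<inter> ?S) \<inter> ?B) = emeasure lborel (sgn -` A \<inter> ?B)"
    using measure_orthogonal_image[OF f lm[OF fA]] by (simp only: img)
  then show "emeasure (distr sphere_measure sphere_measure f) A = emeasure sphere_measure A"
    using val[OF A] val[OF fA] by (simp only: emeasure_distr[OF meas A] space_sphere_measure)
qed

text \<open>Only the values on the sphere matter, so a spherical polynomial is a function on \<open>real ^ 3\<close>
  whose restriction to the sphere is polynomial.\<close>

definition spherical_polynomial :: "nat \<Rightarrow> (real ^ 3 \<Rightarrow> real) \<Rightarrow> bool" where
  "spherical_polynomial t f \<longleftrightarrow>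
     (\<exists>c :: nat \<Rightarrow> nat \<Rightarrow> nat \<Rightarrow> real. \<forall>x \<in> sphere 0 1.
        f x = (\<Sum>i\<le>t. \<Sum>j\<le>t - i. \<Sum>k\<le>t - i - j. c i j k * x $ 1 ^ i * x $ 2 ^ j * x $ 3 ^ k))"

definition spherical_design :: "nat \<Rightarrow> nat \<Rightarrow> (nat \<Rightarrow> real ^ 3) \<Rightarrow> bool" where
  "spherical_design t M n \<longleftrightarrow>
     M \<ge> 1 \<and> (\<forall>k \<in> {1..M}. n k \<in> sphere 0 1) \<and>
     (\<forall>f. spherical_polynomial t f \<longrightarrow>
        (\<Sum>k = 1..M. f (n k)) / real M = (\<integral>x. f x \<partial>sphere_measure) / (4 * pi))"


section \<open>The spin-J representation\<close>

text \<open>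
  Throughout, \<open>N\<close> is the natural number \<open>2 * J\<close>, operators are \<open>(N + 1) \<times> (N + 1)\<close> matrices in the
  standard basis, and the index \<open>j \<in> {0..N}\<close> stands for the basis vector with \<open>m = J - j\<close>; in
  particular \<open>unit_vec (N + 1) 0\<close> is the highest-weight vector. Directions are indexed by the type
  \<open>3\<close>, with \<open>1, 2, 3\<close> for \<open>x, y, z\<close>.
\<close>

definition mat_trace :: "complex mat \<Rightarrow> complex" where
  "mat_trace A = (\<Sum>i<dim_row A. A $$ (i, i))"

definition spin_plus :: "nat \<Rightarrow> complex mat" where
  "spin_plus N = mat (N + 1) (N + 1) (\<lambda>(i, j).
     let J = real N / 2; m = J - real j
     in if i + 1 = j then of_real (sqrt (J * (J + 1) - m * (m + 1))) else 0)"

definition spin_minus :: "nat \<Rightarrow> complex mat" where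
  "spin_minus N = mat (N + 1) (N + 1) (\<lambda>(i, j).
     let J = real N / 2; m = J - real j
     in if i = j + 1 then of_real (sqrt (J * (J + 1) - m * (m - 1))) else 0)"

definition spin_op :: "nat \<Rightarrow> 3 \<Rightarrow> complex mat" where
  "spin_op N a =
     (if a = 1 then (1 / 2) \<cdot>\<^sub>m (spin_plus N + spin_minus N)
      else if a = 2 then (1 / (2 * \<i>)) \<cdot>\<^sub>m (spin_plus N - spin_minus N)
      else mat (N + 1) (N + 1) (\<lambda>(i, j). if i = j then of_real (real N / 2 - real j) else 0))"

definition pauli :: "real ^ 3 \<Rightarrow> complex mat" where
  "pauli v = mat_of_rows_list 2
     [[of_real (v $ 3), of_real (v $ 1) - \<i> * of_real (v $ 2)],
      [of_real (v $ 1) + \<i> * of_real (v $ 2), - of_real (v $ 3)]]"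

definition SU2 :: "complex mat set" where
  "SU2 = {g \<in> carrier_mat 2 2. mat_adjoint g * g = 1\<^sub>m 2 \<and> Determinant.det g = 1}"

text \<open>
  The spin-\<open>J\<close> representation is the \<open>N\<close>-th symmetric power of the defining representation: \<open>SU2\<close>
  acts on homogeneous polynomials of degree \<open>N\<close> in \<open>u, v\<close> by
  \<open>u \<mapsto> g\<^sub>0\<^sub>0 u + g\<^sub>1\<^sub>0 v\<close>, \<open>v \<mapsto> g\<^sub>0\<^sub>1 u + g\<^sub>1\<^sub>1 v\<close>, and the basis vector with index \<open>j\<close> is
  \<open>sqrt (N choose j) u\<^bsup>N - j\<^esup> v\<^bsup>j\<^esup>\<close>. Below the polynomials are dehomogenised at \<open>u = 1\<close>.
  The lemmas \<open>spin_rep_mult\<close> and \<open>spin_rep_generator\<close> show that this is a representation whose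
  infinitesimal generators are the operators \<open>spin_op\<close>.
\<close>

definition spin_rep :: "nat \<Rightarrow> complex mat \<Rightarrow> complex mat" where
  "spin_rep N g = mat (N + 1) (N + 1) (\<lambda>(i, j).
     of_real (sqrt (real (N choose j) / real (N choose i))) *
     coeff ([:g $$ (0, 0), g $$ (1, 0):] ^ (N - j) * [:g $$ (0, 1), g $$ (1, 1):] ^ j) i)"

lemma coeff_homogeneous_eq_0:
  fixes p q :: "complex poly"
  assumes "degree p \<le> 1" "degree q \<le> 1" "k > m + j"
  shows "coeff (p ^ m * q ^ j) k = 0"
proof (rule coeff_eq_0)
  have "degree (p ^ m * q ^ j) \<le> degree (p ^ m) + degree (q ^ j)" by (rule degree_mult_le)
  also have "\<dots> \<le> degree p * m + degree q * j" by (intro add_mono degree_power_le)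
  also have "\<dots> \<le> 1 * m + 1 * j" using assms by (intro add_mono mult_right_mono) auto
  finally show "degree (p ^ m * q ^ j) < k" using assms by simp
qed

lemma homogeneous_subst_step:
  fixes A B p :: "complex poly"
  assumes "degree p \<le> m"
  shows "(\<Sum>k\<le>Suc m. Polynomial.smult (coeff ([:a, c:] * p) k) (A ^ (Suc m - k) * B ^ k))
       = (Polynomial.smult a A + Polynomial.smult c B) * (\<Sum>k\<le>m. Polynomial.smult (coeff p k) (A ^ (m - k) * B ^ k))"
proof -
  have co: "coeff ([:a, c:] * p) k = a * coeff p k + (case k of 0 \<Rightarrow> 0 | Suc l \<Rightarrow> c * coeff p l)" for k
    by (cases k) auto
  have "(\<Sum>k\<le>Suc m. Polynomial.smult (coeff ([:a, c:] * p) k) (A ^ (Suc m - k) * B ^ k))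
      = (\<Sum>k\<le>Suc m. Polynomial.smult (a * coeff p k) (A ^ (Suc m - k) * B ^ k))
      + (\<Sum>k\<le>Suc m. Polynomial.smult (case k of 0 \<Rightarrow> 0 | Suc l \<Rightarrow> c * coeff p l) (A ^ (Suc m - k) * B ^ k))"
    by (simp only: co smult_add_left sum.distrib)
  also have "(\<Sum>k\<le>Suc m. Polynomial.smult (a * coeff p k) (A ^ (Suc m - k) * B ^ k))
      = Polynomial.smult a A * (\<Sum>k\<le>m. Polynomial.smult (coeff p k) (A ^ (m - k) * B ^ k))"
    using assms
    by (simp add: coeff_eq_0 sum_distrib_left Suc_diff_le mult_ac)
  also have "(\<Sum>k\<le>Suc m. Polynomial.smult (case k of 0 \<Rightarrow> 0 | Suc l \<Rightarrow> c * coeff p l) (A ^ (Suc m - k) * B ^ k))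
      = Polynomial.smult c B * (\<Sum>k\<le>m. Polynomial.smult (coeff p k) (A ^ (m - k) * B ^ k))"
    by (subst sum.atMost_Suc_shift) (auto simp: sum_distrib_left mult_ac intro!: sum.cong)
  finally show ?thesis by (simp add: algebra_simps)
qed

lemma homogeneous_subst:
  fixes A B :: "complex poly"
  shows "(\<Sum>k\<le>m + j. Polynomial.smult (coeff ([:a, c:] ^ m * [:b, d:] ^ j) k) (A ^ (m + j - k) * B ^ k))
       = (Polynomial.smult a A + Polynomial.smult c B) ^ m * (Polynomial.smult b A + Polynomial.smult d B) ^ j"
proof (induction m)
  case 0
  show ?case
  proof (induction j)
    case (Suc j)
    have "degree ([:b, d:] ^ j) \<le> j"
      using degree_power_le[of "[:b, d:]" j] by (auto intro: order_trans)
    from homogeneous_subst_step[OF this, of b d A B] Suc show ?case by simp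
  qed simp
next
  case (Suc m)
  have "degree ([:a, c:] ^ m * [:b, d:] ^ j) \<le> m + j"
    by (rule degree_le) (auto intro: coeff_homogeneous_eq_0)
  from homogeneous_subst_step[OF this, of a c A B] show ?case
    by (simp only: add_Suc power_Suc mult.assoc Suc.IH)
qed

theorem spin_rep_mult:
  assumes g: "g \<in> carrier_mat 2 2" and h: "h \<in> carrier_mat 2 2"
  shows "spin_rep N (g * h) = spin_rep N g * spin_rep N h"
proof (rule eq_matI)
  fix i j assume "i < dim_row (spin_rep N g * spin_rep N h)" "j < dim_col (spin_rep N g * spin_rep N h)"
  then have i: "i \<le> N" and j: "j \<le> N" by (auto simp: spin_rep_def)
  define A where "A = [:g $$ (0, 0), g $$ (1, 0):]"
  define B where "B = [:g $$ (0, 1), g $$ (1, 1):]"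
  define p where "p = [:h $$ (0, 0), h $$ (1, 0):] ^ (N - j) * [:h $$ (0, 1), h $$ (1, 1):] ^ j"
  define w :: "nat \<Rightarrow> nat \<Rightarrow> complex"
    where "w i k = of_real (sqrt (real (N choose k) / real (N choose i)))" for i k
  have ww: "w i k * w k j = w i j" if "k \<le> N" for k
    using that i j by (simp add: w_def flip: of_real_mult real_sqrt_mult)
  have gh: "(g * h) $$ (x, y) = g $$ (x, 0) * h $$ (0, y) + g $$ (x, 1) * h $$ (1, y)"
    if "x < 2" "y < 2" for x y
    using that g h by (simp add: times_mat_def scalar_prod_def numeral_2_eq_2)
  have "(spin_rep N g * spin_rep N h) $$ (i, j)
      = (\<Sum>k\<le>N. (w i k * coeff (A ^ (N - k) * B ^ k) i) * (w k j * coeff p k))"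
    using i j by (simp add: spin_rep_def times_mat_def scalar_prod_def A_def B_def p_def w_def
        lessThan_Suc_atMost atLeast0LessThan)
  also have "\<dots> = w i j * (\<Sum>k\<le>N. coeff p k * coeff (A ^ (N - k) * B ^ k) i)"
    unfolding sum_distrib_left by (intro sum.cong refl) (use ww in \<open>simp flip: ww add: mult_ac\<close>)
  also have "(\<Sum>k\<le>N. coeff p k * coeff (A ^ (N - k) * B ^ k) i)
      = coeff (\<Sum>k\<le>N. Polynomial.smult (coeff p k) (A ^ (N - k) * B ^ k)) i"
    by (simp add: coeff_sum)
  also have "(\<Sum>k\<le>N. Polynomial.smult (coeff p k) (A ^ (N - k) * B ^ k))
      = (Polynomial.smult (h $$ (0, 0)) A + Polynomial.smult (h $$ (1, 0)) B) ^ (N - j)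
        * (Polynomial.smult (h $$ (0, 1)) A + Polynomial.smult (h $$ (1, 1)) B) ^ j"
    using homogeneous_subst[where m = "N - j" and j = j] j by (simp add: p_def)
  finally show "spin_rep N (g * h) $$ (i, j) = (spin_rep N g * spin_rep N h) $$ (i, j)"
    using i j by (simp add: spin_rep_def w_def gh A_def B_def mult_ac)
qed (auto simp: spin_rep_def)


definition poly_deriv0 :: "(real \<Rightarrow> complex poly) \<Rightarrow> complex poly \<Rightarrow> bool" where
  "poly_deriv0 p p' \<longleftrightarrow> (\<forall>k. ((\<lambda>s. coeff (p s) k) has_vector_derivative coeff p' k) (at 0))"

lemma poly_deriv0_mult:
  assumes "poly_deriv0 p p'" "poly_deriv0 q q'"
  shows "poly_deriv0 (\<lambda>s. p s * q s) (p 0 * q' + p' * q 0)"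
  unfolding poly_deriv0_def
proof
  fix k
  have "((\<lambda>s. \<Sum>i\<le>k. coeff (p s) i * coeff (q s) (k - i)) has_vector_derivative
     (\<Sum>i\<le>k. coeff (p 0) i * coeff q' (k - i) + coeff p' i * coeff (q 0) (k - i))) (at 0)"
    using assms unfolding poly_deriv0_def
    by (intro has_vector_derivative_sum has_vector_derivative_mult) auto
  then show "((\<lambda>s. coeff (p s * q s) k) has_vector_derivative coeff (p 0 * q' + p' * q 0) k) (at 0)"
    by (simp add: coeff_mult sum.distrib)
qed

lemma poly_deriv0_power:
  assumes "poly_deriv0 p p'"
  shows "poly_deriv0 (\<lambda>s. p s ^ m) (of_nat m * p 0 ^ (m - 1) * p')"
proof (induction m)
  case 0
  then show ?case by (simp add: poly_deriv0_def)
next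
  case (Suc m)
  have "p 0 * (of_nat m * p 0 ^ (m - 1) * p') + p' * p 0 ^ m = of_nat (Suc m) * p 0 ^ (Suc m - 1) * p'"
    by (cases m) (auto simp: algebra_simps)
  with poly_deriv0_mult[OF assms Suc] show ?case by simp
qed

lemma sqrt_binomial_ratio:
  assumes "j < N"
  shows "sqrt (real (N choose j) / real (N choose Suc j)) * real (N - j) = sqrt (real (Suc j) * real (N - j))"
    and "sqrt (real (N choose Suc j) / real (N choose j)) * real (Suc j) = sqrt (real (Suc j) * real (N - j))"
proof -
  have "Suc j * (N choose Suc j) = (N - j) * (N choose j)"
    by (metis binomial_absorption binomial_absorb_comp)
  then have e: "real (Suc j) * real (N choose Suc j) = real (N - j) * real (N choose j)"
    by (metis of_nat_mult)
  have pos: "real (N choose Suc j) > 0" "real (N choose j) > 0" "real (N - j) > 0" "real (Suc j) > 0"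
    using assms by auto
  have r1: "real (N choose j) / real (N choose Suc j) = real (Suc j) / real (N - j)"
    using e pos by (simp add: field_simps del: of_nat_Suc)
  have r2: "real (N choose Suc j) / real (N choose j) = real (N - j) / real (Suc j)"
    using e pos by (simp add: field_simps del: of_nat_Suc)
  have gen: "sqrt (x / y) * y = sqrt (x * y)" if "x > 0" "y > 0" for x y :: real
  proof -
    have "sqrt (x / y) * y = sqrt (x / y) * sqrt (y ^ 2)" using that by simp
    also have "\<dots> = sqrt (x / y * y ^ 2)" by (simp only: real_sqrt_mult)
    also have "x / y * y ^ 2 = x * y" using that by (simp add: power2_eq_square)
    finally show ?thesis .
  qed
  show "sqrt (real (N choose j) / real (N choose Suc j)) * real (N - j) = sqrt (real (Suc j) * real (N - j))"
    unfolding r1 using pos by (intro gen)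
  show "sqrt (real (N choose Suc j) / real (N choose j)) * real (Suc j) = sqrt (real (Suc j) * real (N - j))"
    unfolding r2 using gen[OF pos(3,4)] by (simp only: mult.commute)
qed

theorem spin_rep_generator:
  fixes g :: "real \<Rightarrow> complex mat" and v :: "real ^ 3"
  assumes g0: "g 0 = 1\<^sub>m 2"
    and g': "\<And>i j. i < 2 \<Longrightarrow> j < 2 \<Longrightarrow>
      ((\<lambda>s. g s $$ (i, j)) has_vector_derivative - (\<i> / 2) * pauli v $$ (i, j)) (at 0)"
    and i: "i \<le> N" and j: "j \<le> N"
  shows "((\<lambda>s. spin_rep N (g s) $$ (i, j)) has_vector_derivative
           - \<i> * (\<Sum>a\<in>UNIV. of_real (v $ a) * spin_op N a $$ (i, j))) (at 0)"
proof -
  define A where "A s = [:g s $$ (0, 0), g s $$ (1, 0):]" for s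
  define B where "B s = [:g s $$ (0, 1), g s $$ (1, 1):]" for s
  define A' where "A' = [:- (\<i> / 2) * pauli v $$ (0, 0), - (\<i> / 2) * pauli v $$ (1, 0):]"
  define B' where "B' = [:- (\<i> / 2) * pauli v $$ (0, 1), - (\<i> / 2) * pauli v $$ (1, 1):]"
  define w :: complex where "w = of_real (sqrt (real (N choose j) / real (N choose i)))"
  define X where "X = [:0, 1 :: complex:]"
  have A: "poly_deriv0 A A'" and B: "poly_deriv0 B B'"
    unfolding poly_deriv0_def A_def A'_def B_def B'_def using g'
    by (auto simp: coeff_pCons split: nat.split)
  have A0: "A 0 = 1" and B0: "B 0 = X"
    by (auto simp: A_def B_def X_def g0 one_pCons)
  have "poly_deriv0 (\<lambda>s. A s ^ (N - j) * B s ^ j)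
     (of_nat j * X ^ (j - 1) * B' + of_nat (N - j) * A' * X ^ j)"
    using poly_deriv0_mult[OF poly_deriv0_power[OF A] poly_deriv0_power[OF B], of "N - j" j]
    by (simp add: A0 B0)
  then have "((\<lambda>s. w * coeff (A s ^ (N - j) * B s ^ j) i) has_vector_derivative
      w * coeff (of_nat j * X ^ (j - 1) * B' + of_nat (N - j) * A' * X ^ j) i) (at 0)"
    unfolding poly_deriv0_def by (intro has_vector_derivative_mult_right) auto
  moreover have "(\<lambda>s. spin_rep N (g s) $$ (i, j)) = (\<lambda>s. w * coeff (A s ^ (N - j) * B s ^ j) i)"
    using i j by (simp add: spin_rep_def A_def B_def w_def)
  moreover have "w * coeff (of_nat j * X ^ (j - 1) * B' + of_nat (N - j) * A' * X ^ j) i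
      = - \<i> * (\<Sum>a\<in>UNIV. of_real (v $ a) * spin_op N a $$ (i, j))"
  proof -
    have X: "X ^ k = monom 1 k" for k by (simp add: X_def monom_altdef)
    define cc where "cc = coeff (of_nat j * X ^ (j - 1) * B' + of_nat (N - j) * A' * X ^ j) i"
    have cf: "cc
      = of_nat j * (if i < j - 1 then 0 else coeff B' (i - (j - 1)))
        + of_nat (N - j) * (if i < j then 0 else coeff A' (i - j))"
      by (simp add: cc_def X of_nat_poly coeff_monom_mult mult.assoc mult.commute[of A']) auto
    have p: "pauli v $$ (0, 0) = of_real (v $ 3)"
      "pauli v $$ (0, Suc 0) = of_real (v $ 1) - \<i> * of_real (v $ 2)"
      "pauli v $$ (Suc 0, 0) = of_real (v $ 1) + \<i> * of_real (v $ 2)"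
      "pauli v $$ (Suc 0, Suc 0) = - of_real (v $ 3)"
      by (auto simp: pauli_def mat_of_rows_list_def)
    have hi: "coeff A' k = 0" "coeff B' k = 0" if "k > 1" for k
      using that by (auto intro!: coeff_eq_0 simp: A'_def B'_def)
    consider (diag) "i = j" | (lower) "i = Suc j" | (upper) "j = Suc i"
      | (far) "i \<noteq> j" "i \<noteq> Suc j" "j \<noteq> Suc i" by blast
    then have "w * cc = - \<i> * (\<Sum>a\<in>UNIV. of_real (v $ a) * spin_op N a $$ (i, j))"
    proof cases
      case diag
      have "w = 1" using diag j by (simp add: w_def)
      moreover have "cc
          = of_nat j * coeff B' 1 + of_nat (N - j) * coeff A' 0"
        unfolding cf using diag by (cases j) auto
      ultimately show ?thesis using diag j
        by (simp add: sum_3 spin_op_def spin_plus_def spin_minus_def Let_def A'_def B'_def p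
            of_nat_diff field_simps)
    next
      case lower
      have jN: "j < N" using lower i by simp
      have "w * of_nat (N - j) = of_real (sqrt (real (Suc j) * real (N - j)))"
        unfolding w_def lower sqrt_binomial_ratio(1)[OF jN, symmetric] by simp
      moreover have "real N / 2 * (real N / 2 + 1) - (real N / 2 - real j) * (real N / 2 - real j - 1)
          = real (Suc j) * real (N - j)"
        using j by (simp add: of_nat_diff field_simps)
      moreover have "cc
          = of_nat (N - j) * coeff A' 1"
        unfolding cf using lower by (cases j) (auto simp: hi)
      ultimately show ?thesis using lower i j
        by (simp add: sum_3 spin_op_def spin_plus_def spin_minus_def Let_def A'_def B'_def p
            mult.assoc[symmetric] del: of_nat_Suc) (simp add: field_simps)
    next
      case upper
      have iN: "i < N" using upper j by simp
      have "w * of_nat j = of_real (sqrt (real (Suc i) * real (N - i)))"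
        unfolding w_def upper sqrt_binomial_ratio(2)[OF iN, symmetric] by simp
      moreover have "real N / 2 * (real N / 2 + 1) - (real N / 2 - real j) * (real N / 2 - real j + 1)
          = real (Suc i) * real (N - i)"
        using upper i by (simp add: of_nat_diff field_simps)
      moreover have "cc
          = of_nat j * coeff B' 0"
        unfolding cf using upper by auto
      ultimately show ?thesis using upper i j
        by (simp add: sum_3 spin_op_def spin_plus_def spin_minus_def Let_def A'_def B'_def p
            mult.assoc[symmetric] del: of_nat_Suc) (simp add: field_simps)
    next
      case far
      have "cc = 0"
        unfolding cf using far
        by (cases "j = 0") (auto simp: hi)
      then show ?thesis using far i j
        by (simp add: sum_3 spin_op_def spin_plus_def spin_minus_def)
    qed
    then show ?thesis by (simp only: cc_def)
  qed
  ultimately show ?thesis by simp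
qed


section \<open>Coherent states\<close>

text \<open>\<open>g\<close> is one of the two preimages of \<open>A\<close> under the double cover of \<open>SO(3)\<close> by \<open>SU(2)\<close>.\<close>

definition SU2_lift :: "real ^ 3 ^ 3 \<Rightarrow> complex mat \<Rightarrow> bool" where
  "SU2_lift A g \<longleftrightarrow>
     rotation_matrix A \<and> g \<in> SU2 \<and> (\<forall>v. pauli (A *v v) = g * pauli v * mat_adjoint g)"

definition lifts_pole_to :: "real ^ 3 \<Rightarrow> complex mat \<Rightarrow> bool" where
  "lifts_pole_to p g \<longleftrightarrow> (\<exists>A. SU2_lift A g \<and> A *v axis 3 1 = p)"

lemma mat2_eqI:
  assumes "A \<in> carrier_mat 2 2" "B \<in> carrier_mat 2 2"
    and "A $$ (0, 0) = B $$ (0, 0)" "A $$ (0, Suc 0) = B $$ (0, Suc 0)"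
    and "A $$ (Suc 0, 0) = B $$ (Suc 0, 0)" "A $$ (Suc 0, Suc 0) = B $$ (Suc 0, Suc 0)"
  shows "A = B"
  using assms by (intro eq_matI) (auto simp: less_2_cases_iff)

lemma mat2_mult_index:
  assumes "A \<in> carrier_mat 2 2" "B \<in> carrier_mat 2 2" "i < 2" "j < 2"
  shows "(A * B) $$ (i, j) = A $$ (i, 0) * B $$ (0, j) + A $$ (i, Suc 0) * B $$ (Suc 0, j)"
  using assms by (simp add: times_mat_def scalar_prod_def numeral_2_eq_2)

lemma mat2_det:
  fixes A :: "complex mat"
  assumes A: "A \<in> carrier_mat 2 2"
  shows "Determinant.det A = A $$ (0, 0) * A $$ (Suc 0, Suc 0) - A $$ (Suc 0, 0) * A $$ (0, Suc 0)"
proof -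
  have d: "Determinant.det (mat_delete A i 0) = mat_delete A i 0 $$ (0, 0)" if "i < 2" for i
    using that A by (intro det_single) (auto simp: mat_delete_def)
  have "Determinant.det A = (\<Sum>i<2. A $$ (i, 0) * cofactor A i 0)"
    using laplace_expansion_column[OF A, of 0] by simp
  also have "\<dots> = A $$ (0, 0) * A $$ (Suc 0, Suc 0) - A $$ (Suc 0, 0) * A $$ (0, Suc 0)"
    using A d[of 0] d[of 1] by (simp add: numeral_2_eq_2 cofactor_def mat_delete_def)
  finally show ?thesis .
qed

lemma mat_adjoint_index:
  fixes A :: "complex mat"
  assumes "i < dim_col A" "j < dim_row A"
  shows "mat_adjoint A $$ (i, j) = cnj (A $$ (j, i))"
  using assms by (simp add: mat_adjoint_def mat_of_rows_index)

lemma mat_of_rows_list_2_index [simp]: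
  "mat_of_rows_list 2 [[a, b], [c, d]] $$ (0, 0) = a"
  "mat_of_rows_list 2 [[a, b], [c, d]] $$ (0, Suc 0) = b"
  "mat_of_rows_list 2 [[a, b], [c, d]] $$ (Suc 0, 0) = c"
  "mat_of_rows_list 2 [[a, b], [c, d]] $$ (Suc 0, Suc 0) = d"
  by (auto simp: mat_of_rows_list_def)

lemma quaternion_lift:
  fixes w p q r :: real
  assumes s: "w\<^sup>2 + p\<^sup>2 + q\<^sup>2 + r\<^sup>2 = 1"
  defines "A \<equiv> vector
     [vector [1 - 2 * (q\<^sup>2 + r\<^sup>2), 2 * (p * q - r * w), 2 * (p * r + q * w)],
      vector [2 * (p * q + r * w), 1 - 2 * (p\<^sup>2 + r\<^sup>2), 2 * (q * r - p * w)],
      vector [2 * (p * r - q * w), 2 * (q * r + p * w), 1 - 2 * (p\<^sup>2 + q\<^sup>2)]] :: real ^ 3 ^ 3"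
    and "g \<equiv> mat_of_rows_list 2 [[Complex w (- r), Complex (- q) (- p)], [Complex q (- p), Complex w r]]"
  shows "SU2_lift A g"
proof -
  have ww: "w * w = 1 - p * p - q * q - r * r" using s by (simp add: power2_eq_square)
  have wwx: "w * (w * x) = (1 - p * p - q * q - r * r) * x" for x
    using ww by (simp add: mult.assoc[symmetric])
  have orth: "orthogonal_matrix A"
    unfolding orthogonal_matrix_def Finite_Cartesian_Product.vec_eq_iff A_def forall_3
    by (simp add: matrix_matrix_mult_def Finite_Cartesian_Product.transpose_def
        Finite_Cartesian_Product.mat_def sum_3) (simp add: ww wwx power2_eq_square algebra_simps)
  have det: "Determinants.det A = 1"
    unfolding A_def det_3 by (simp add: ww wwx power2_eq_square algebra_simps)
  have dims: "g \<in> carrier_mat 2 2" by (auto simp: g_def mat_of_rows_list_def)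
  have gi: "g $$ (0, 0) = Complex w (- r)" "g $$ (0, Suc 0) = Complex (- q) (- p)"
    "g $$ (Suc 0, 0) = Complex q (- p)" "g $$ (Suc 0, Suc 0) = Complex w r"
    by (simp_all add: g_def)
  have dimsa: "mat_adjoint g \<in> carrier_mat 2 2"
    using dims by (auto simp: mat_adjoint_def)
  have dimsp: "pauli u \<in> carrier_mat 2 2" for u
    by (auto simp: pauli_def mat_of_rows_list_def)
  have pi: "pauli u $$ (0, 0) = of_real (u $ 3)"
    "pauli u $$ (0, Suc 0) = of_real (u $ 1) - \<i> * of_real (u $ 2)"
    "pauli u $$ (Suc 0, 0) = of_real (u $ 1) + \<i> * of_real (u $ 2)"
    "pauli u $$ (Suc 0, Suc 0) = - of_real (u $ 3)" for u
    by (simp_all add: pauli_def)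
  have adj: "mat_adjoint g $$ (i, j) = cnj (g $$ (j, i))" if "i < 2" "j < 2" for i j
    using that dims by (intro mat_adjoint_index) auto
  have unit: "mat_adjoint g * g = 1\<^sub>m 2"
    by (rule mat2_eqI[OF mult_carrier_mat[OF dimsa dims]])
       (simp_all add: mat2_mult_index[OF dimsa dims] adj gi complex_eq_iff ww wwx
          power2_eq_square algebra_simps)
  have detg: "Determinant.det g = 1"
    by (simp add: mat2_det[OF dims]) (auto simp: gi complex_eq_iff ww wwx algebra_simps)
  have "pauli (A *v v) = g * pauli v * mat_adjoint g" for v
    by (rule mat2_eqI[OF dimsp mult_carrier_mat[OF mult_carrier_mat[OF dims dimsp] dimsa]])
       (simp_all add: mat2_mult_index[OF mult_carrier_mat[OF dims dimsp] dimsa]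
          mat2_mult_index[OF dims dimsp] adj gi pi complex_eq_iff
          matrix_vector_mult_def sum_3 A_def ww wwx power2_eq_square algebra_simps)
  with orth det unit detg dims show ?thesis
    by (auto simp: SU2_lift_def rotation_matrix_def SU2_def)
qed


lemma exists_lift:
  assumes "n \<in> sphere 0 1"
  shows "\<exists>g. lifts_pole_to n g"
proof -
  define x y z where "x = n $ 1" and "y = n $ 2" and "z = n $ 3"
  have n1: "x\<^sup>2 + y\<^sup>2 + z\<^sup>2 = 1"
    using assms by (simp add: norm_vec_def L2_set_def sum_3 x_def y_def z_def)
  have n: "n = vector [x, y, z]"
    by (simp add: Finite_Cartesian_Product.vec_eq_iff forall_3 x_def y_def z_def)
  show ?thesis
  proof (cases "z = -1")
    case True
    with n1 have "x = 0" "y = 0" by (auto simp: sum_power2_eq_zero_iff)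
    have s: "0\<^sup>2 + 1\<^sup>2 + 0\<^sup>2 + 0\<^sup>2 = (1 :: real)" by simp
    show ?thesis
      unfolding lifts_pole_to_def
      by (intro exI conjI, rule quaternion_lift[OF s])
         (simp_all add: n True \<open>x = 0\<close> \<open>y = 0\<close> Finite_Cartesian_Product.vec_eq_iff
        forall_3 matrix_vector_mult_def sum_3 axis_def)
  next
    case False
    have "z\<^sup>2 \<le> 1" using n1 by (smt (verit) zero_le_power2)
    then have "z > -1" using False by (auto simp: abs_square_le_1 abs_le_iff)
    define w where "w = sqrt ((1 + z) / 2)"
    have w: "w > 0" "w\<^sup>2 = (1 + z) / 2" using \<open>z > -1\<close> by (auto simp: w_def)
    define p q where "p = - y / (2 * w)" and "q = x / (2 * w)"
    have pw: "p * w = - y / 2" "q * w = x / 2" using w by (auto simp: p_def q_def)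
    have "p\<^sup>2 + q\<^sup>2 = (x\<^sup>2 + y\<^sup>2) / (4 * w\<^sup>2)"
      by (simp add: p_def q_def power_divide power_mult_distrib add_divide_distrib)
    also have "\<dots> = (1 - z) * (1 + z) / (2 * (1 + z))"
    proof -
      have e: "x\<^sup>2 + y\<^sup>2 = (1 - z) * (1 + z)"
        using n1 by (simp add: power2_eq_square algebra_simps)
      have "4 * ((1 + z) / 2) = 2 * (1 + z)" by simp
      then show ?thesis unfolding e w(2) by (simp only:)
    qed
    also have "\<dots> = (1 - z) / 2" using \<open>z > -1\<close> by (intro nonzero_mult_divide_mult_cancel_right) simp
    finally have pq: "p\<^sup>2 + q\<^sup>2 = (1 - z) / 2" .
    have s: "w\<^sup>2 + p\<^sup>2 + q\<^sup>2 + 0\<^sup>2 = 1" using pq w by (simp add: field_simps)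
    show ?thesis
      unfolding lifts_pole_to_def
      by (intro exI conjI, rule quaternion_lift[OF s]) (use pq pw in \<open>simp add: n Finite_Cartesian_Product.vec_eq_iff
        forall_3 matrix_vector_mult_def sum_3 axis_def\<close>)
  qed
qed

corollary exists_lift_section: "\<exists>R. \<forall>p \<in> sphere 0 1. lifts_pole_to p (R p)"
  using exists_lift by metis

definition coherent_state :: "nat \<Rightarrow> complex mat \<Rightarrow> complex vec" where
  "coherent_state N g = spin_rep N g *\<^sub>v unit_vec (N + 1) 0"

definition rank_one :: "complex vec \<Rightarrow> complex mat" where
  "rank_one v = mat (dim_vec v) (dim_vec v) (\<lambda>(i, j). vec_index v i * cnj (vec_index v j))"

text \<open>The argument \<open>R\<close> assigns to each point of the sphere an element of \<open>SU(2)\<close> over a rotation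
  taking the north pole to that point; such an assignment exists by \<open>exists_lift_section\<close>.\<close>

definition coherent_projector :: "nat \<Rightarrow> (real ^ 3 \<Rightarrow> complex mat) \<Rightarrow> real ^ 3 \<Rightarrow> complex mat" where
  "coherent_projector N R p = rank_one (coherent_state N (R p))"

definition povm ::
  "nat \<Rightarrow> (real ^ 3 \<Rightarrow> complex mat) \<Rightarrow> nat \<Rightarrow> (nat \<Rightarrow> real ^ 3) \<Rightarrow> nat \<Rightarrow> complex mat" where
  "povm N R M n k = (of_nat (N + 1) / of_nat M) \<cdot>\<^sub>m coherent_projector N R (n k)"


section \<open>States, covariance and estimators\<close>

definition density_operator :: "nat \<Rightarrow> complex mat \<Rightarrow> bool" where
  "density_operator d \<rho> \<longleftrightarrow>
     \<rho> \<in> carrier_mat d d \<and> mat_adjoint \<rho> = \<rho> \<and>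
     (\<forall>v \<in> carrier_vec d. Re ((\<rho> *\<^sub>v v) \<bullet>c v) \<ge> 0) \<and> mat_trace \<rho> = 1"

definition spin_covariance :: "nat \<Rightarrow> complex mat \<Rightarrow> 3 \<Rightarrow> 3 \<Rightarrow> complex" where
  "spin_covariance N \<rho> a b =
     mat_trace (\<rho> * ((1 / 2) \<cdot>\<^sub>m (spin_op N a * spin_op N b + spin_op N b * spin_op N a)))
     - mat_trace (\<rho> * spin_op N a) * mat_trace (\<rho> * spin_op N b)"

definition obs_X :: "real \<Rightarrow> (nat \<Rightarrow> real ^ 3) \<Rightarrow> 3 \<Rightarrow> nat \<Rightarrow> real" where
  "obs_X J n a k = (J + 1) * n k $ a"

definition obs_Y :: "real \<Rightarrow> (nat \<Rightarrow> real ^ 3) \<Rightarrow> 3 \<Rightarrow> 3 \<Rightarrow> nat \<Rightarrow> real" where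
  "obs_Y J n a b k =
     (J + 1) * (2 * J + 3) / 2 * (n k $ a) * (n k $ b) - (J + 1) / 2 * (if a = b then 1 else 0)"

text \<open>In the estimators, \<open>\<kappa> 1, \<dots>, \<kappa> Ns\<close> are the observed outcomes.\<close>

definition mu_hat :: "real \<Rightarrow> (nat \<Rightarrow> real ^ 3) \<Rightarrow> nat \<Rightarrow> 3 \<Rightarrow> (nat \<Rightarrow> nat) \<Rightarrow> real" where
  "mu_hat J n Ns a \<kappa> = (\<Sum>i = 1..Ns. obs_X J n a (\<kappa> i)) / real Ns"

definition C_hat :: "real \<Rightarrow> (nat \<Rightarrow> real ^ 3) \<Rightarrow> nat \<Rightarrow> 3 \<Rightarrow> 3 \<Rightarrow> (nat \<Rightarrow> nat) \<Rightarrow> real" where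
  "C_hat J n Ns a b \<kappa> = (\<Sum>i = 1..Ns. obs_Y J n a b (\<kappa> i)) / real Ns"

definition q_hat :: "real \<Rightarrow> (nat \<Rightarrow> real ^ 3) \<Rightarrow> nat \<Rightarrow> 3 \<Rightarrow> 3 \<Rightarrow> (nat \<Rightarrow> nat) \<Rightarrow> real" where
  "q_hat J n Ns a b \<kappa> = (\<Sum>i = 1..Ns. obs_X J n a (\<kappa> i) * obs_X J n b (\<kappa> i)) / real Ns"

definition Gamma_hat :: "real \<Rightarrow> (nat \<Rightarrow> real ^ 3) \<Rightarrow> nat \<Rightarrow> 3 \<Rightarrow> 3 \<Rightarrow> (nat \<Rightarrow> nat) \<Rightarrow> real" where
  "Gamma_hat J n Ns a b \<kappa> =
     C_hat J n Ns a b \<kappa>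
     - (real Ns * mu_hat J n Ns a \<kappa> * mu_hat J n Ns b \<kappa> - q_hat J n Ns a b \<kappa>) / (real Ns - 1)"

end

theory Submission
  imports Defs
begin

text \<open>
  A design averages polynomials of degree at most \<open>t\<close> like the sphere does, so its finite averages
  inherit rotation invariance; this determines every moment needed without computing an integral.
  With \<open>u = (1 + z) / 2\<close> and \<open>v = (1 - z) / 2\<close>, differentiating the average of \<open>u\<^sup>p v\<^sup>q x\<close> along
  the rotations about the \<open>y\<close>-axis gives \<open>(q + 1) I(p + 1, q) = (p + 1) I(p, q + 1)\<close> for
  \<open>I(p, q)\<close> the average of \<open>u\<^sup>p v\<^sup>q\<close>, whence \<open>I(p, q) = p! q! / (p + q + 1)!\<close>, while
  rotations about the \<open>z\<close>-axis kill the monomials with a nontrivial phase. If \<open>\<alpha>, \<beta>\<close> is the first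
  column of the \<open>SU(2)\<close> lift, then \<open>u = \<bar>\<alpha>\<bar>\<^sup>2\<close>, \<open>v = \<bar>\<beta>\<bar>\<^sup>2\<close> and \<open>(x + i y) / 2\<close> is the product of
  \<open>\<beta>\<close> with the conjugate of \<open>\<alpha>\<close>, so the matrix entries of \<open>X\<^sub>a\<close> and \<open>Y\<^sub>a\<^sub>b\<close> averaged against
  the POVM are such moments, and they agree with those of \<open>J\<^sub>a\<close> and \<open>(J\<^sub>a J\<^sub>b + J\<^sub>b J\<^sub>a) / 2\<close>. The
  subtracted term of the estimator is the average of \<open>X\<^sub>a(k\<^sub>i) X\<^sub>b(k\<^sub>j)\<close> over \<open>i \<noteq> j\<close>, which is
  unbiased for the product of the means by independence.
\<close>

section \<open>Rotation invariance of design averages\<close>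

text \<open>Generating the functions monomial by monomial makes closure properties inductions. The
  value type is generic because the design property concerns real functions while the phase argument
  needs complex ones.\<close>

inductive poly3 :: "nat \<Rightarrow> (real ^ 3 \<Rightarrow> 'a :: {real_algebra_1, comm_ring_1}) \<Rightarrow> bool" for t where
  zero: "poly3 t (\<lambda>_. 0)"
| add_monomial: "poly3 t f \<Longrightarrow> p + q + r \<le> t \<Longrightarrow>
    poly3 t (\<lambda>x. f x + c * of_real (x $ 1 ^ p * x $ 2 ^ q * x $ 3 ^ r))"

lemma poly3_monomial:
  "p + q + r \<le> t \<Longrightarrow> poly3 t (\<lambda>x. c * of_real (x $ 1 ^ p * x $ 2 ^ q * x $ 3 ^ r))"
  using poly3.add_monomial[OF poly3.zero] by fastforce

lemma poly3_mono: "poly3 t f \<Longrightarrow> t \<le> t' \<Longrightarrow> poly3 t' f"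
  by (induction rule: poly3.induct) (blast intro: poly3.intros le_trans)+

lemma poly3_const: "poly3 t (\<lambda>_. c)"
  using poly3_monomial[of 0 0 0 t c] by simp

lemma poly3_coord: "poly3 1 (\<lambda>x. of_real (x $ i))"
  using poly3_monomial[of 1 0 0 1 1] poly3_monomial[of 0 1 0 1 1] poly3_monomial[of 0 0 1 1 1]
    exhaust_3[of i] by auto

lemma poly3_add: "poly3 t g \<Longrightarrow> poly3 t f \<Longrightarrow> poly3 t (\<lambda>x. f x + g x)"
proof (induction rule: poly3.induct)
  case (add_monomial g p q r c)
  then show ?case
    using poly3.add_monomial[of t "\<lambda>x. f x + g x" p q r c] by (simp add: add.assoc)
qed simp

lemma poly3_monomial_mult:
  assumes "poly3 e g" "p + q + r \<le> d"
  shows "poly3 (d + e) (\<lambda>x. c * of_real (x $ 1 ^ p * x $ 2 ^ q * x $ 3 ^ r) * g x)"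
  using assms(1)
proof (induction rule: poly3.induct)
  case (add_monomial g p' q' r' c')
  have "poly3 (d + e) (\<lambda>x. c * of_real (x $ 1 ^ p * x $ 2 ^ q * x $ 3 ^ r) * g x
      + (c * c') * of_real (x $ 1 ^ (p + p') * x $ 2 ^ (q + q') * x $ 3 ^ (r + r')))"
    using add_monomial assms(2) by (intro poly3.add_monomial) auto
  then show ?case by (simp add: power_add algebra_simps)
qed (simp add: poly3.zero)

lemma poly3_mult:
  assumes "poly3 d f" "poly3 e g"
  shows "poly3 (d + e) (\<lambda>x. f x * g x)"
  using assms(1)
proof (induction rule: poly3.induct)
  case (add_monomial f p q r c)
  then show ?case
    using poly3_add[OF poly3_monomial_mult[OF assms(2), of p q r d c] add_monomial(3)]
    by (simp add: distrib_right)
qed (simp add: poly3.zero)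

lemma poly3_power: "poly3 d f \<Longrightarrow> poly3 (m * d) (\<lambda>x. f x ^ m)"
  by (induction m) (auto intro: poly3_const poly3_mult)

lemma poly3_scale: "poly3 d f \<Longrightarrow> poly3 d (\<lambda>x. c * f x)"
  using poly3_mult[OF poly3_const[of 0 c]] by simp

lemma poly3_of_real: "poly3 d f \<Longrightarrow> poly3 d (\<lambda>x. of_real (f x))"
proof (induction rule: poly3.induct)
  case (add_monomial f p q r c)
  then show ?case
    using poly3.add_monomial[of d "\<lambda>x. of_real (f x)" p q r "of_real c"] by simp
qed (simp add: poly3.zero)

lemma poly3_Re_Im:
  assumes "poly3 d f"
  shows "poly3 d (\<lambda>x. Re (f x))" "poly3 d (\<lambda>x. Im (f x))"
proof -
  show "poly3 d (\<lambda>x. Re (f x))" using assms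
  proof (induction rule: poly3.induct)
    case (add_monomial f p q r c)
    then show ?case
      using poly3.add_monomial[of d "\<lambda>x. Re (f x)" p q r "Re c"] by simp
  qed (simp add: poly3.zero)
  show "poly3 d (\<lambda>x. Im (f x))" using assms
  proof (induction rule: poly3.induct)
    case (add_monomial f p q r c)
    then show ?case
      using poly3.add_monomial[of d "\<lambda>x. Im (f x)" p q r "Im c"] by simp
  qed (simp add: poly3.zero)
qed

text \<open>Each coordinate of a linear image is a linear form, so a monomial becomes a product of
  equally many linear forms and the degree bound survives.\<close>

lemma poly3_compose_linear:
  fixes f :: "real ^ 3 \<Rightarrow> 'a :: {real_algebra_1, comm_ring_1}" and g :: "real ^ 3 \<Rightarrow> real ^ 3"
  assumes "poly3 d f" "linear g"
  shows "poly3 d (\<lambda>x. f (g x))"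
proof -
  have g: "poly3 1 (\<lambda>x. g x $ i)" for i
  proof -
    have "g x $ i = (matrix g *v x) $ i" for x
      using matrix_vector_mul(2)[OF assms(2)] by metis
    then have "g x $ i = (\<Sum>j\<in>UNIV. matrix g $ i $ j * of_real (x $ j))" for x
      by (simp add: matrix_vector_mult_def)
    then show ?thesis
      unfolding sum_3 by (simp only: poly3_add poly3_scale poly3_coord)
  qed
  show ?thesis using assms(1)
  proof (induction rule: poly3.induct)
    case (add_monomial f p q r c)
    have "poly3 (p * 1 + q * 1 + r * 1) (\<lambda>x. g x $ 1 ^ p * g x $ 2 ^ q * g x $ 3 ^ r)"
      by (intro poly3_mult poly3_power g)
    then have "poly3 d (\<lambda>x. c * of_real (g x $ 1 ^ p * g x $ 2 ^ q * g x $ 3 ^ r))"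
      using add_monomial by (intro poly3_scale poly3_of_real) (auto intro: poly3_mono)
    then show ?case using add_monomial by (intro poly3_add)
  qed (simp add: poly3.zero)
qed

lemma poly3_continuous_on: "poly3 d (f :: real ^ 3 \<Rightarrow> real) \<Longrightarrow> continuous_on A f"
  by (induction rule: poly3.induct) (auto intro!: continuous_intros)

section \<open>From polynomial functions to design averages\<close>

lemma spherical_polynomial_if_poly3:
  assumes "poly3 t f"
  shows "spherical_polynomial t f"
  using assms
proof (induction rule: poly3.induct)
  case zero
  show ?case unfolding spherical_polynomial_def by (rule exI[of _ "\<lambda>_ _ _. 0"]) simp
next
  case (add_monomial f p q r c)
  from add_monomial(3) obtain C where C: "\<And>x. x \<in> sphere 0 1 \<Longrightarrow>
      f x = (\<Sum>i\<le>t. \<Sum>j\<le>t - i. \<Sum>k\<le>t - i - j. C i j k * x $ 1 ^ i * x $ 2 ^ j * x $ 3 ^ k)"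
    unfolding spherical_polynomial_def by blast
  \<comment> \<open>The coefficient array of the added monomial; its triple sum collapses to the one
    index triple \<open>p\<close>, \<open>q\<close>, \<open>r\<close>, which lies in range by the
    degree bound.\<close>
  define e where "e i j k = (if i = p \<and> j = q \<and> k = r then c else 0)" for i j k
  have single: "sum h A = h l" if "finite A" "l \<in> A" "\<And>i. i \<noteq> l \<Longrightarrow> h i = 0"
    for h :: "nat \<Rightarrow> real" and l A
    using that by (subst sum.mono_neutral_right[of A "{l}"]) auto
  have "(\<Sum>i\<le>t. \<Sum>j\<le>t - i. \<Sum>k\<le>t - i - j. e i j k * x $ 1 ^ i * x $ 2 ^ j * x $ 3 ^ k)
      = e p q r * x $ 1 ^ p * x $ 2 ^ q * x $ 3 ^ r" for x :: "real ^ 3"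
    using add_monomial(2)
    by (subst single[of _ p], simp, simp, simp add: e_def, subst single[of _ q], simp, simp,
        simp add: e_def, subst single[of _ r]) (simp_all add: e_def)
  then have "f x + c * of_real (x $ 1 ^ p * x $ 2 ^ q * x $ 3 ^ r)
      = (\<Sum>i\<le>t. \<Sum>j\<le>t - i. \<Sum>k\<le>t - i - j. (C i j k + e i j k) * x $ 1 ^ i * x $ 2 ^ j * x $ 3 ^ k)"
    if "x \<in> sphere 0 1" for x
    using C[OF that] by (simp add: distrib_right sum.distrib e_def mult.assoc)
  then show ?case
    unfolding spherical_polynomial_def by (intro exI[of _ "\<lambda>i j k. C i j k + e i j k"]) simp
qed

text \<open>Change of variables along \<open>g\<close> under the rotation-invariant measure;
  continuity supplies Borel measurability.\<close>

lemma integral_sphere_measure_rotate: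
  fixes f :: "real ^ 3 \<Rightarrow> real" and g :: "real ^ 3 \<Rightarrow> real ^ 3"
  assumes f: "continuous_on UNIV f" and g: "orthogonal_transformation g"
  shows "(\<integral>x. f (g x) \<partial>sphere_measure) = (\<integral>x. f x \<partial>sphere_measure)"
proof -
  have "g \<in> borel_measurable borel"
    using g by (intro borel_measurable_continuous_onI)
      (simp add: linear_continuous_on linear_linear orthogonal_transformation_linear)
  then have gm: "g \<in> measurable sphere_measure sphere_measure"
    unfolding measurable_cong_sets[OF sets_sphere_measure sets_sphere_measure]
    by (rule measurable_restrict_space3) (use g in \<open>auto simp: orthogonal_transformation_norm\<close>)
  have "f \<in> borel_measurable borel" using f by (rule borel_measurable_continuous_onI)
  then have "f \<in> borel_measurable sphere_measure"
    unfolding measurable_cong_sets[OF sets_sphere_measure refl] by (rule measurable_restrict_space1)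
  from integral_distr[OF gm this] show ?thesis
    by (simp add: sphere_measure_rotation_invariant[OF g])
qed

text \<open>Composition with \<open>g\<close> preserves the degree bound and the sphere integral, so
  both design averages equal the same integral; \<open>M\<close> is positive, so the division
  cancels.\<close>

lemma design_sum_rotate_real:
  fixes f :: "real ^ 3 \<Rightarrow> real"
  assumes d: "spherical_design t M n" and f: "poly3 t f" and g: "orthogonal_transformation g"
  shows "(\<Sum>k = 1..M. f (g (n k))) = (\<Sum>k = 1..M. f (n k))"
proof -
  have avg: "(\<Sum>k = 1..M. h (n k)) / real M = (\<integral>x. h x \<partial>sphere_measure) / (4 * pi)"
    if "poly3 t h" for h
    using d spherical_polynomial_if_poly3[OF that] unfolding spherical_design_def by blast
  have "poly3 t (\<lambda>x. f (g x))"
    by (rule poly3_compose_linear[OF f orthogonal_transformation_linear[OF g]])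
  from avg[OF this] avg[OF f]
  have "(\<Sum>k = 1..M. f (g (n k))) / real M = (\<Sum>k = 1..M. f (n k)) / real M"
    by (simp only: integral_sphere_measure_rotate[OF poly3_continuous_on[OF f] g])
  then show ?thesis using d by (simp add: spherical_design_def)
qed

lemma design_sum_rotate:
  fixes f :: "real ^ 3 \<Rightarrow> complex"
  assumes d: "spherical_design t M n" and f: "poly3 t f" and g: "orthogonal_transformation g"
  shows "(\<Sum>k = 1..M. f (g (n k))) = (\<Sum>k = 1..M. f (n k))"
  using design_sum_rotate_real[OF d poly3_Re_Im(1)[OF f] g]
    design_sum_rotate_real[OF d poly3_Re_Im(2)[OF f] g]
  by (simp add: complex_eq_iff)

section \<open>Moments of a design\<close>

definition rot_z :: "real \<Rightarrow> real ^ 3 \<Rightarrow> real ^ 3" where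
  "rot_z \<theta> x = vector [cos \<theta> * x $ 1 - sin \<theta> * x $ 2, sin \<theta> * x $ 1 + cos \<theta> * x $ 2, x $ 3]"

definition rot_y :: "real \<Rightarrow> real ^ 3 \<Rightarrow> real ^ 3" where
  "rot_y \<theta> x = vector [cos \<theta> * x $ 1 + sin \<theta> * x $ 3, x $ 2, cos \<theta> * x $ 3 - sin \<theta> * x $ 1]"

lemma rot_nth [simp]:
  "rot_z \<theta> x $ 1 = cos \<theta> * x $ 1 - sin \<theta> * x $ 2" "rot_z \<theta> x $ 2 = sin \<theta> * x $ 1 + cos \<theta> * x $ 2"
  "rot_z \<theta> x $ 3 = x $ 3"
  "rot_y \<theta> x $ 1 = cos \<theta> * x $ 1 + sin \<theta> * x $ 3" "rot_y \<theta> x $ 2 = x $ 2"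
  "rot_y \<theta> x $ 3 = cos \<theta> * x $ 3 - sin \<theta> * x $ 1"
  by (simp_all add: rot_z_def rot_y_def)

lemma plane_rotation_inner:
  fixes a b a' b' :: real
  shows "(cos \<theta> * a - sin \<theta> * b) * (cos \<theta> * a' - sin \<theta> * b')
    + (sin \<theta> * a + cos \<theta> * b) * (sin \<theta> * a' + cos \<theta> * b') = a * a' + b * b'"
proof -
  have "(cos \<theta> * a - sin \<theta> * b) * (cos \<theta> * a' - sin \<theta> * b')
    + (sin \<theta> * a + cos \<theta> * b) * (sin \<theta> * a' + cos \<theta> * b')
    = ((cos \<theta>)\<^sup>2 + (sin \<theta>)\<^sup>2) * (a * a' + b * b')"
    by (simp only: power2_eq_square) (simp only: algebra_simps)
  then show ?thesis by simp
qed

lemma orthogonal_transformation_rot_z: "orthogonal_transformation (rot_z \<theta>)"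
proof -
  have "linear (rot_z \<theta>)"
    by (rule linearI) (simp_all add: Finite_Cartesian_Product.vec_eq_iff forall_3 algebra_simps)
  moreover have "inner (rot_z \<theta> x) (rot_z \<theta> y) = inner x y" for x y
    using plane_rotation_inner[of \<theta> "x $ 1" "x $ 2" "y $ 1" "y $ 2"]
    by (simp only: inner_vec_def sum_3 rot_nth inner_real_def)
  ultimately show ?thesis by (simp add: orthogonal_transformation_def)
qed

lemma orthogonal_transformation_rot_y: "orthogonal_transformation (rot_y \<theta>)"
proof -
  have "linear (rot_y \<theta>)"
    by (rule linearI) (simp_all add: Finite_Cartesian_Product.vec_eq_iff forall_3 algebra_simps)
  moreover have "inner (rot_y \<theta> x) (rot_y \<theta> y) = inner x y" for x y
    \<comment> \<open>The plane turned by \<open>rot_y\<close> is taken in the order z, x to match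
      the signs.\<close>
    using plane_rotation_inner[of \<theta> "x $ 3" "x $ 1" "y $ 3" "y $ 1"]
    by (simp only: inner_vec_def sum_3 rot_nth inner_real_def ac_simps)
  ultimately show ?thesis by (simp add: orthogonal_transformation_def)
qed

section \<open>Moments in the height coordinate\<close>

lemma poly3_half_height:
  "poly3 1 (\<lambda>x. (1 + x $ 3) / 2 :: real)" "poly3 1 (\<lambda>x. (1 - x $ 3) / 2 :: real)"
proof -
  have c: "poly3 1 (\<lambda>x. x $ 3 :: real)" using poly3_coord[of 3, where 'a = real] by simp
  show "poly3 1 (\<lambda>x. (1 + x $ 3) / 2 :: real)"
    using poly3_add[OF poly3_scale[OF c, of "1 / 2"] poly3_const[of 1 "1 / 2"]]
    by (simp add: add_divide_distrib)
  show "poly3 1 (\<lambda>x. (1 - x $ 3) / 2 :: real)"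
    using poly3_add[OF poly3_scale[OF c, of "- (1 / 2)"] poly3_const[of 1 "1 / 2"]]
    by (simp add: diff_divide_distrib)
qed

lemma poly3_half_height_powers:
  "poly3 (p + q) (\<lambda>x. ((1 + x $ 3) / 2) ^ p * ((1 - x $ 3) / 2) ^ q :: real)"
  using poly3_mult[OF poly3_power[OF poly3_half_height(1), of p] poly3_power[OF poly3_half_height(2), of q]]
  by simp

lemma sphere_3_iff: "x \<in> sphere 0 1 \<longleftrightarrow> (x $ 1)\<^sup>2 + (x $ 2)\<^sup>2 + (x $ 3)\<^sup>2 = 1" for x :: "real ^ 3"
  by (simp add: norm_vec_def L2_set_def sum_3)

text \<open>Here \<open>x\<^sup>2\<close> and \<open>y\<^sup>2\<close> have equal averages, and \<open>x\<^sup>2 + y\<^sup>2 = 4 u v\<close>.\<close>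

lemma design_sum_square:
  assumes d: "spherical_design t M n" and "p + q + 2 \<le> t"
  shows "(\<Sum>k = 1..M. ((1 + n k $ 3) / 2) ^ p * ((1 - n k $ 3) / 2) ^ q * (n k $ 1)\<^sup>2)
    = 2 * (\<Sum>k = 1..M. ((1 + n k $ 3) / 2) ^ Suc p * ((1 - n k $ 3) / 2) ^ Suc q)"
proof -
  let ?h = "\<lambda>x :: real ^ 3. ((1 + x $ 3) / 2) ^ p * ((1 - x $ 3) / 2) ^ q"
  have "poly3 1 (\<lambda>x. x $ 1 :: real)" using poly3_coord[of 1, where 'a = real] by simp
  from poly3_mult[OF poly3_half_height_powers[of p q] poly3_power[OF this, of 2]]
  have "poly3 t (\<lambda>x. ?h x * (x $ 1)\<^sup>2)" using assms(2) by (simp add: poly3_mono)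
  \<comment> \<open>The quarter turn about the z-axis exchanges the squares of x and y and fixes the
    height.\<close>
  from design_sum_rotate_real[OF d this orthogonal_transformation_rot_z[of "pi / 2"]]
  have "2 * (\<Sum>k = 1..M. ?h (n k) * (n k $ 1)\<^sup>2)
      = (\<Sum>k = 1..M. ?h (n k) * (n k $ 1)\<^sup>2) + (\<Sum>k = 1..M. ?h (n k) * (n k $ 2)\<^sup>2)"
    by simp
  also have "\<dots> = (\<Sum>k = 1..M. 4 * (((1 + n k $ 3) / 2) ^ Suc p * ((1 - n k $ 3) / 2) ^ Suc q))"
    unfolding sum.distrib[symmetric]
  proof (intro sum.cong refl)
    fix k assume "k \<in> {1..M}"
    then have "n k \<in> sphere 0 1" using d by (simp add: spherical_design_def)
    then have "(n k $ 1)\<^sup>2 + (n k $ 2)\<^sup>2 = 4 * ((1 + n k $ 3) / 2 * ((1 - n k $ 3) / 2))"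
      unfolding sphere_3_iff by (simp add: power2_eq_square field_simps)
    then show "?h (n k) * (n k $ 1)\<^sup>2 + ?h (n k) * (n k $ 2)\<^sup>2
        = 4 * (((1 + n k $ 3) / 2) ^ Suc p * ((1 - n k $ 3) / 2) ^ Suc q)"
      unfolding distrib_left[symmetric] by (simp only: power_Suc mult_ac)
  qed
  also have "\<dots> = 4 * (\<Sum>k = 1..M. ((1 + n k $ 3) / 2) ^ Suc p * ((1 - n k $ 3) / 2) ^ Suc q)"
    by (rule sum_distrib_left[symmetric])
  finally show ?thesis by linarith
qed

lemma design_sum_recurrence:
  assumes d: "spherical_design t M n" and t: "p + q + 1 \<le> t"
  defines "I \<equiv> \<lambda>p q. \<Sum>k = 1..M. ((1 + n k $ 3) / 2) ^ p * ((1 - n k $ 3) / 2) ^ q"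
  shows "real (Suc q) * I (Suc p) q = real (Suc p) * I p (Suc q)"
proof -
  let ?u = "\<lambda>x :: real ^ 3. (1 + x $ 3) / 2" and ?v = "\<lambda>x :: real ^ 3. (1 - x $ 3) / 2"
  let ?f = "\<lambda>x :: real ^ 3. ?u x ^ p * ?v x ^ q * x $ 1"
  \<comment> \<open>The derivative of \<open>?f\<close> along \<open>rot_y\<close> at angle 0, where
    u' = - x / 2, v' = x / 2 and x' = z = u - v. The truncated exponents \<open>q - 1\<close> and
    \<open>p - 1\<close> at 0 carry a zero factor.\<close>
  define D where "D x = (real q / 2 * (?u x ^ p * ?v x ^ (q - 1) * (x $ 1)\<^sup>2)
      - real p / 2 * (?u x ^ (p - 1) * ?v x ^ q * (x $ 1)\<^sup>2))
      + (?u x ^ Suc p * ?v x ^ q - ?u x ^ p * ?v x ^ Suc q)" for x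
  have "poly3 1 (\<lambda>x. x $ 1 :: real)" using poly3_coord[of 1, where 'a = real] by simp
  from poly3_mult[OF poly3_half_height_powers[of p q] this]
  have f: "poly3 t ?f" using t by (simp add: poly3_mono)
  have "((\<lambda>\<theta>. \<Sum>k = 1..M. ?f (rot_y \<theta> (n k))) has_real_derivative (\<Sum>k = 1..M. D (n k))) (at 0)"
  proof (intro DERIV_sum)
    fix k
    show "((\<lambda>\<theta>. ?f (rot_y \<theta> (n k))) has_real_derivative D (n k)) (at 0)"
      unfolding D_def rot_nth
      by (auto intro!: derivative_eq_intros simp: power2_eq_square) (simp add: field_simps)
  qed
  \<comment> \<open>By rotation invariance the summed function of the angle is constant, so the sum
    of the derivatives vanishes.\<close>
  moreover have "(\<lambda>\<theta>. \<Sum>k = 1..M. ?f (rot_y \<theta> (n k))) = (\<lambda>_. \<Sum>k = 1..M. ?f (n k))"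
    by (intro ext design_sum_rotate_real[OF d f] orthogonal_transformation_rot_y)
  ultimately have "((\<lambda>_. \<Sum>k = 1..M. ?f (n k)) has_real_derivative (\<Sum>k = 1..M. D (n k))) (at 0)"
    by simp
  from DERIV_unique[OF this DERIV_const] have z: "(\<Sum>k = 1..M. D (n k)) = 0" .
  have "(\<Sum>k = 1..M. D (n k)) = real q / 2 * (\<Sum>k = 1..M. ?u (n k) ^ p * ?v (n k) ^ (q - 1) * (n k $ 1)\<^sup>2)
      - real p / 2 * (\<Sum>k = 1..M. ?u (n k) ^ (p - 1) * ?v (n k) ^ q * (n k $ 1)\<^sup>2)
      + (I (Suc p) q - I p (Suc q))"
    unfolding D_def I_def by (simp only: sum.distrib sum_subtractf sum_distrib_left[symmetric])
  \<comment> \<open>\<open>design_sum_square\<close> trades the square of x for 2 u v, which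
    restores the exponent lowered by differentiation; for \<open>q = 0\<close> both sides are
    zero.\<close>
  also have "real q / 2 * (\<Sum>k = 1..M. ?u (n k) ^ p * ?v (n k) ^ (q - 1) * (n k $ 1)\<^sup>2)
      = real q * I (Suc p) q"
    using design_sum_square[OF d, of p "q - 1"] t by (cases q) (simp_all add: I_def)
  also have "real p / 2 * (\<Sum>k = 1..M. ?u (n k) ^ (p - 1) * ?v (n k) ^ q * (n k $ 1)\<^sup>2)
      = real p * I p (Suc q)"
    using design_sum_square[OF d, of "p - 1" q] t by (cases p) (simp_all add: I_def)
  finally show ?thesis using z by (simp add: algebra_simps)
qed

text \<open>The value is \<open>M\<close> times the Beta integral of u^p (1 - u)^q over
  [0, 1].\<close>

lemma design_sum_beta:
  assumes d: "spherical_design t M n" and t: "p + q \<le> t"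
  shows "(\<Sum>k = 1..M. ((1 + n k $ 3) / 2) ^ p * ((1 - n k $ 3) / 2) ^ q)
    = real M * fact p * fact q / fact (Suc (p + q))"
proof -
  define I where "I p q = (\<Sum>k = 1..M. ((1 + n k $ 3) / 2) ^ p * ((1 - n k $ 3) / 2) ^ q)" for p q
  \<comment> \<open>Since u + v = 1, the two neighbours of \<open>I p q\<close> have a known sum;
    the recurrence gives their ratio, so each is a multiple of \<open>I p q\<close>.\<close>
  have add: "I (Suc p) q + I p (Suc q) = I p q" for p q
    unfolding I_def sum.distrib[symmetric] by (intro sum.cong refl) (simp add: field_simps)
  have rec: "real (Suc q) * I (Suc p) q = real (Suc p) * I p (Suc q)" if "p + q + 1 \<le> t" for p q
    using design_sum_recurrence[OF d that] by (simp add: I_def)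
  have left: "I (Suc p) q = real (Suc p) / real (p + q + 2) * I p q" if "p + q + 1 \<le> t" for p q
  proof -
    have "real (p + q + 2) * I (Suc p) q = real (Suc p) * (I (Suc p) q + I p (Suc q))"
      using rec[OF that] by (simp add: algebra_simps)
    then show ?thesis unfolding add by (simp add: field_simps)
  qed
  have right: "I p (Suc q) = real (Suc q) / real (p + q + 2) * I p q" if "p + q + 1 \<le> t" for p q
  proof -
    have "real (p + q + 2) * I p (Suc q) = real (Suc q) * (I (Suc p) q + I p (Suc q))"
      using rec[OF that] by (simp add: algebra_simps)
    then show ?thesis unfolding add by (simp add: field_simps)
  qed
  \<comment> \<open>From \<open>I 0 0 = M\<close> the induction first raises \<open>q\<close> with
    \<open>p = 0\<close>, then raises \<open>p\<close>.\<close>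
  have "I 0 q = real M * fact q / fact (Suc q)" if "q \<le> t" for q
    using that
  proof (induction q)
    case (Suc q)
    then show ?case using right[of 0 q] by (simp add: divide_simps mult.commute)
  qed (simp add: I_def)
  then have "I p q = real M * fact p * fact q / fact (Suc (p + q))"
    using t
  proof (induction p)
    case (Suc p)
    then have "I (Suc p) q = real (Suc p) / real (p + q + 2) * (real M * fact p * fact q / fact (Suc (p + q)))"
      using left[of p q] by simp
    also have "\<dots> = real M * (real (Suc p) * fact p) * fact q / (real (p + q + 2) * fact (Suc (p + q)))"
      by (simp only: times_divide_times_eq mult_ac)
    finally show ?case by simp
  qed simp
  then show ?thesis by (simp add: I_def)
qed

text \<open>The rotation by pi / r about the z-axis fixes the height and multiplies (x + i y)^r by
  -1, so the invariant sum equals its own negative.\<close>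

lemma design_sum_phase:
  assumes d: "spherical_design t M n" and t: "p + q + r \<le> t" and r: "r > 0"
  shows "(\<Sum>k = 1..M. complex_of_real (((1 + n k $ 3) / 2) ^ p * ((1 - n k $ 3) / 2) ^ q)
    * (Complex (n k $ 1) (n k $ 2) / 2) ^ r) = 0"
proof -
  let ?f = "\<lambda>x :: real ^ 3. complex_of_real (((1 + x $ 3) / 2) ^ p * ((1 - x $ 3) / 2) ^ q)
    * (Complex (x $ 1) (x $ 2) / 2) ^ r"
  have "poly3 1 (\<lambda>x. Complex (x $ 1) (x $ 2) / 2)"
    using poly3_scale[OF poly3_add[OF poly3_scale[OF poly3_coord[of 2], of \<i>] poly3_coord[of 1]], of "1 / 2"]
    by (simp add: Complex_eq)
  from poly3_mult[OF poly3_of_real[OF poly3_half_height_powers[of p q]] poly3_power[OF this, of r]]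
  have f: "poly3 t ?f" using t by (simp add: poly3_mono)
  have "?f (rot_z (pi / r) x) = - ?f x" for x
  proof -
    have "Complex (rot_z (pi / r) x $ 1) (rot_z (pi / r) x $ 2) = cis (pi / r) * Complex (x $ 1) (x $ 2)"
      by (simp add: complex_eq_iff)
    moreover have "cis (pi / r) ^ r = -1" using r unfolding Complex.DeMoivre by simp
    ultimately show ?thesis by (simp add: power_mult_distrib power_divide)
  qed
  then have "(\<Sum>k = 1..M. ?f (n k)) = - (\<Sum>k = 1..M. ?f (n k))"
    using design_sum_rotate[OF d f orthogonal_transformation_rot_z[of "pi / r"]]
    by (simp add: sum_negf)
  then show ?thesis by simp
qed

text \<open>Equally many plain and conjugated factors let the monomial be regrouped into u, v and a
  power of (x + i y) / 2 or of its conjugate, of total degree \<open>a + c\<close>. Such a power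
  kills the sum; without one the Beta value remains.\<close>

lemma design_moment:
  fixes \<alpha> \<beta> :: "nat \<Rightarrow> complex"
  assumes d: "spherical_design t M n"
    and u: "\<And>k. k \<in> {1..M} \<Longrightarrow> \<alpha> k * cnj (\<alpha> k) = of_real ((1 + n k $ 3) / 2)"
    and v: "\<And>k. k \<in> {1..M} \<Longrightarrow> \<beta> k * cnj (\<beta> k) = of_real ((1 - n k $ 3) / 2)"
    and w: "\<And>k. k \<in> {1..M} \<Longrightarrow> cnj (\<alpha> k) * \<beta> k = Complex (n k $ 1) (n k $ 2) / 2"
    and eq: "a + c = b + d'" and t: "a + c \<le> t"
  shows "(\<Sum>k = 1..M. \<alpha> k ^ a * cnj (\<alpha> k) ^ b * \<beta> k ^ c * cnj (\<beta> k) ^ d')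
    = (if a = b then of_nat M * fact a * fact c / fact (Suc (a + c)) else 0)"
proof -
  have phase: "(\<Sum>k = 1..M. \<alpha> k ^ a * cnj (\<alpha> k) ^ (a + r) * \<beta> k ^ (d' + r) * cnj (\<beta> k) ^ d') = 0"
    if "r > 0" "a + d' + r \<le> t" for a d' r
  proof -
    have "(\<Sum>k = 1..M. \<alpha> k ^ a * cnj (\<alpha> k) ^ (a + r) * \<beta> k ^ (d' + r) * cnj (\<beta> k) ^ d')
        = (\<Sum>k = 1..M. (\<alpha> k * cnj (\<alpha> k)) ^ a * (\<beta> k * cnj (\<beta> k)) ^ d' * (cnj (\<alpha> k) * \<beta> k) ^ r)"
      by (simp add: power_add power_mult_distrib mult_ac)
    also have "\<dots> = 0"
      using design_sum_phase[OF d that(2,1)] by (simp add: u v w)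
    finally show ?thesis .
  qed
  consider (eq) "a = b" | (less) r where "b = a + r" "r > 0" | (greater) r where "a = b + r" "r > 0"
    by (metis less_imp_add_positive linorder_neqE_nat)
  then show ?thesis
  proof cases
    case eq
    then have "(\<Sum>k = 1..M. \<alpha> k ^ a * cnj (\<alpha> k) ^ b * \<beta> k ^ c * cnj (\<beta> k) ^ d')
        = (\<Sum>k = 1..M. (\<alpha> k * cnj (\<alpha> k)) ^ a * (\<beta> k * cnj (\<beta> k)) ^ c)"
      using \<open>a + c = b + d'\<close> by (simp add: power_mult_distrib mult_ac)
    also have "\<dots> = of_real (\<Sum>k = 1..M. ((1 + n k $ 3) / 2) ^ a * ((1 - n k $ 3) / 2) ^ c)"
      by (simp add: u v)
    also have "\<dots> = of_nat M * fact a * fact c / fact (Suc (a + c))"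
      unfolding design_sum_beta[OF d t] by simp
    finally show ?thesis using eq by simp
  next
    case less
    then have "c = d' + r" using eq by simp
    with less phase[of r a d'] t show ?thesis by simp
  next
    case greater
    then have "d' = c + r" using eq by simp
    \<comment> \<open>An excess of plain over conjugated first components is the complex conjugate
      of the opposite case.\<close>
    have "(\<Sum>k = 1..M. \<alpha> k ^ a * cnj (\<alpha> k) ^ b * \<beta> k ^ c * cnj (\<beta> k) ^ d')
      = cnj (\<Sum>k = 1..M. \<alpha> k ^ b * cnj (\<alpha> k) ^ (b + r) * \<beta> k ^ (c + r) * cnj (\<beta> k) ^ c)"
      using greater \<open>d' = c + r\<close> by (simp add: mult_ac)
    also have "\<dots> = 0" using phase[of r b c] greater t by simp
    finally show ?thesis using greater by simp
  qed
qed

section \<open>Matrix entries in the standard basis\<close>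

text \<open>Unitarity and determinant 1 determine the second column of \<open>g\<close> from the
  first; the entries are then read off from the Pauli matrix of \<open>p\<close>, the conjugate by
  \<open>g\<close> of the diagonal matrix with entries 1 and -1.\<close>

lemma lifts_pole_to_entries:
  assumes "lifts_pole_to p g"
  shows "g $$ (0, 0) * cnj (g $$ (0, 0)) = of_real ((1 + p $ 3) / 2)"
    and "g $$ (1, 0) * cnj (g $$ (1, 0)) = of_real ((1 - p $ 3) / 2)"
    and "cnj (g $$ (0, 0)) * g $$ (1, 0) = Complex (p $ 1) (p $ 2) / 2"
proof -
  from assms obtain A where A: "A *v (axis 3 1 :: real ^ 3) = p" and su: "g \<in> SU2"
    and pauli: "pauli p = g * pauli (axis 3 1 :: real ^ 3) * mat_adjoint g"
    unfolding lifts_pole_to_def SU2_lift_def by metis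
  define a b c d where "a = g $$ (0, 0)" and "b = g $$ (1, 0)" and "c = g $$ (0, 1)" and "d = g $$ (1, 1)"
  have g: "g \<in> carrier_mat 2 2" and unit: "mat_adjoint g * g = 1\<^sub>m 2" and "Determinant.det g = 1"
    using su by (auto simp: SU2_def)
  have ga: "mat_adjoint g \<in> carrier_mat 2 2" using g by (auto simp: mat_adjoint_def)
  have p: "pauli v \<in> carrier_mat 2 2" for v by (auto simp: pauli_def mat_of_rows_list_def)
  have adj: "mat_adjoint g $$ (i, j) = cnj (g $$ (j, i))" if "i < 2" "j < 2" for i j
    using that g by (intro mat_adjoint_index) auto
  have det: "a * d - b * c = 1"
    using mat2_det[OF g] \<open>Determinant.det g = 1\<close> by (simp add: a_def b_def c_def d_def)
  have col: "cnj a * a + cnj b * b = 1" and orth: "cnj a * c + cnj b * d = 0"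
    using arg_cong[OF unit, of "\<lambda>m. m $$ (0, 0)"] arg_cong[OF unit, of "\<lambda>m. m $$ (0, Suc 0)"]
    by (simp_all add: mat2_mult_index[OF ga g] adj a_def b_def c_def d_def)
  \<comment> \<open>Here and for \<open>c\<close> below, the determinant is expanded in the column
    relations \<open>col\<close> and \<open>orth\<close>, which solves for the second
    column.\<close>
  have "cnj a * (a * d - b * c) = d * (cnj a * a + cnj b * b) - b * (cnj a * c + cnj b * d)"
    by (simp add: algebra_simps)
  then have d: "d = cnj a" by (simp add: det col orth)
  have "cnj b * (a * d - b * c) = a * (cnj a * c + cnj b * d) - c * (cnj a * a + cnj b * b)"
    by (simp add: algebra_simps)
  then have c: "c = - cnj b" by (simp add: det col orth)
  have e: "pauli p $$ (i, j) = g $$ (i, 0) * cnj (g $$ (j, 0)) - g $$ (i, 1) * cnj (g $$ (j, 1))"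
    if "i < 2" "j < 2" for i j
    using that unfolding pauli
    by (simp add: mat2_mult_index[OF mult_carrier_mat[OF g p] ga] mat2_mult_index[OF g p] adj)
       (simp add: pauli_def axis_def)
  have z: "of_real (p $ 3) = a * cnj a - b * cnj b"
    using e[of 0 0] by (simp add: pauli_def a_def[symmetric] c_def[symmetric, simplified] c)
  have xy: "Complex (p $ 1) (p $ 2) = 2 * (cnj a * b)"
    using e[of 1 0] d
    by (simp add: pauli_def a_def[symmetric] b_def[symmetric, simplified] c_def[symmetric, simplified]
        d_def[symmetric, simplified] c Complex_eq algebra_simps)
  have "of_real ((1 + p $ 3) / 2) = (cnj a * a + cnj b * b + of_real (p $ 3)) / 2"
    by (simp add: col)
  then show "g $$ (0, 0) * cnj (g $$ (0, 0)) = of_real ((1 + p $ 3) / 2)"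
    by (simp add: z a_def[symmetric])
  have "of_real ((1 - p $ 3) / 2) = (cnj a * a + cnj b * b - of_real (p $ 3)) / 2"
    by (simp add: col)
  then show "g $$ (1, 0) * cnj (g $$ (1, 0)) = of_real ((1 - p $ 3) / 2)"
    by (simp add: z b_def[symmetric, simplified])
  show "cnj (g $$ (0, 0)) * g $$ (1, 0) = Complex (p $ 1) (p $ 2) / 2"
    by (simp add: xy a_def b_def)
qed

text \<open>The highest-weight vector selects column 0 of \<open>spin_rep\<close>, whose entries are
  binomial coefficients from the \<open>N\<close>-th power of a linear polynomial; the weight turns
  each into its square root.\<close>

lemma coherent_state_index:
  assumes "i \<le> N"
  shows "vec_index (coherent_state N g) i
    = of_real (sqrt (real (N choose i))) * g $$ (0, 0) ^ (N - i) * g $$ (1, 0) ^ i"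
proof -
  have "of_real (sqrt (1 / real (N choose i))) * of_nat (N choose i)
      = (of_real (sqrt (real (N choose i))) :: complex)"
  proof -
    have "sqrt (1 / real (N choose i)) * real (N choose i) = sqrt (real (N choose i))"
      using assms by (simp add: real_sqrt_divide field_simps)
    then show ?thesis by (metis of_real_mult of_real_of_nat_eq)
  qed
  moreover have "vec_index (coherent_state N g) i = spin_rep N g $$ (i, 0)"
    using assms by (simp add: coherent_state_def spin_rep_def)
  ultimately show ?thesis
    using assms by (simp add: spin_rep_def coeff_linear_poly_power mult_ac)
qed

lemma povm_index:
  assumes "i \<le> N" "j \<le> N"
  shows "povm N R M n k $$ (i, j) = of_nat (N + 1) / of_nat M
    * (of_real (sqrt (real (N choose i))) * R (n k) $$ (0, 0) ^ (N - i) * R (n k) $$ (1, 0) ^ i)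
    * cnj (of_real (sqrt (real (N choose j))) * R (n k) $$ (0, 0) ^ (N - j) * R (n k) $$ (1, 0) ^ j)"
proof -
  have "dim_vec (coherent_state N (R (n k))) = N + 1"
    by (simp add: coherent_state_def spin_rep_def)
  then show ?thesis
    using assms
    by (simp add: povm_def coherent_projector_def rank_one_def coherent_state_index del: of_nat_Suc)
qed

text \<open>The falling factorial, taken in a ring so that arguments such as
  \<open>of_nat N - of_nat i\<close> involve no truncated subtraction.\<close>

definition ffact :: "nat \<Rightarrow> 'a \<Rightarrow> 'a :: comm_ring_1" where
  "ffact k x = (\<Prod>l<k. x - of_nat l)"

lemma ffact_simps [simp]: "ffact 0 x = 1" "ffact (Suc 0) x = x" "ffact 2 x = x * (x - 1)"
  by (simp_all add: ffact_def numeral_2_eq_2)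

lemma fact_eq_ffact_mult:
  "fact (m + k) = ffact k (of_nat (m + k)) * (fact m :: 'a :: {comm_ring_1, semiring_char_0})"
proof (induction k)
  case (Suc k)
  have "ffact (Suc k) (of_nat (m + Suc k)) = of_nat (m + Suc k) * (ffact k (of_nat (m + k)) :: 'a)"
    unfolding ffact_def prod.lessThan_Suc_shift by (simp add: o_def)
  then show ?case using Suc by (simp add: mult_ac)
qed (simp add: ffact_def)

text \<open>Conjugating by the diagonal matrix of the \<open>sqrt (N choose i)\<close> removes all square roots from the
  entries of the spin operators; \<open>spin_coeff\<close> below is the result.\<close>

definition binomial_weight :: "nat \<Rightarrow> nat \<Rightarrow> nat \<Rightarrow> complex" where
  "binomial_weight N i j = of_real (sqrt (real (N choose i)) / sqrt (real (N choose j)))"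

text \<open>The weight is a ratio, so the intermediate index cancels; hence products of spin
  operators can be computed with \<open>spin_coeff\<close> alone.\<close>

lemma binomial_weight_mult:
  assumes "l \<le> N"
  shows "binomial_weight N i l * binomial_weight N l j = binomial_weight N i j"
proof -
  have "sqrt (real (N choose l)) \<noteq> 0" using assms by simp
  then show ?thesis unfolding binomial_weight_def of_real_mult[symmetric] by simp
qed

lemma binomial_weight_self: "i \<le> N \<Longrightarrow> binomial_weight N i i = 1"
  by (simp add: binomial_weight_def)

definition spin_coeff :: "nat \<Rightarrow> 3 \<Rightarrow> nat \<Rightarrow> nat \<Rightarrow> complex" where
  "spin_coeff N a i j =
     (if a = 1 then ((if j = i + 1 then of_nat N - of_nat i else 0) + (if i = j + 1 then of_nat i else 0)) / 2
      else if a = 2 then - (\<i> / 2) * ((if j = i + 1 then of_nat N - of_nat i else 0) - (if i = j + 1 then of_nat i else 0))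
      else if i = j then of_nat N / 2 - of_nat i else 0)"

text \<open>The radicands J (J + 1) - m (m + 1) and J (J + 1) - m (m - 1) factor into integers, and
  \<open>sqrt_binomial_ratio\<close> writes their roots as a ratio of roots of binomials times an
  integer.\<close>

lemma spin_op_index:
  assumes "i \<le> N" "j \<le> N"
  shows "spin_op N a $$ (i, j) = binomial_weight N i j * spin_coeff N a i j"
proof -
  have plus: "spin_plus N $$ (i, j) = binomial_weight N i j * (if j = i + 1 then of_nat N - of_nat i else 0)"
  proof (cases "j = Suc i")
    case True
    then have "i < N" using assms by simp
    have "real N / 2 * (real N / 2 + 1) - (real N / 2 - real j) * (real N / 2 - real j + 1)
        = real (Suc i) * real (N - i)"
      using True \<open>i < N\<close> by (simp add: of_nat_diff field_simps)
    also have "sqrt \<dots> = sqrt (real (N choose i)) / sqrt (real (N choose j)) * real (N - i)"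
      using sqrt_binomial_ratio(1)[OF \<open>i < N\<close>] True by (simp add: real_sqrt_divide)
    finally show ?thesis
      using assms True by (simp add: spin_plus_def Let_def binomial_weight_def of_nat_diff)
  qed (use assms in \<open>simp add: spin_plus_def\<close>)
  have minus: "spin_minus N $$ (i, j) = binomial_weight N i j * (if i = j + 1 then of_nat i else 0)"
  proof (cases "i = Suc j")
    case True
    then have "j < N" using assms by simp
    have "real N / 2 * (real N / 2 + 1) - (real N / 2 - real j) * (real N / 2 - real j - 1)
        = real (Suc j) * real (N - j)"
      using True \<open>j < N\<close> by (simp add: of_nat_diff field_simps)
    also have "sqrt \<dots> = sqrt (real (N choose i)) / sqrt (real (N choose j)) * real i"
      using sqrt_binomial_ratio(2)[OF \<open>j < N\<close>] True by (simp add: real_sqrt_divide)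
    finally show ?thesis
      using assms True by (simp add: spin_minus_def Let_def binomial_weight_def)
  qed (use assms in \<open>simp add: spin_minus_def\<close>)
  have dims: "spin_plus N \<in> carrier_mat (N + 1) (N + 1)" "spin_minus N \<in> carrier_mat (N + 1) (N + 1)"
    by (auto simp: spin_plus_def spin_minus_def)
  consider "a = 1" | "a = 2" | "a = 3" using exhaust_3 by blast
  then show ?thesis
  proof cases
    case 3
    then show ?thesis using assms binomial_weight_self by (simp add: spin_op_def spin_coeff_def)
  next
    case 1
    then show ?thesis using assms dims plus minus
      by (simp add: spin_op_def spin_coeff_def distrib_left)
  next
    case 2
    have "spin_op N a $$ (i, j) = - (\<i> / 2) * (spin_plus N $$ (i, j) - spin_minus N $$ (i, j))"
      using assms dims 2 by (simp add: spin_op_def)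
    then show ?thesis unfolding plus minus by (simp add: 2 spin_coeff_def algebra_simps)
  qed
qed

lemma spin_op_carrier [simp]: "spin_op N a \<in> carrier_mat (N + 1) (N + 1)"
  unfolding spin_op_def spin_plus_def spin_minus_def
  by (auto intro!: smult_carrier_mat add_carrier_mat minus_carrier_mat simp del: One_nat_def)

text \<open>At \<open>i = N\<close> and \<open>i = 0\<close> the values of \<open>f\<close> outside the range (or at the truncated \<open>i - 1\<close>)
  occur with coefficient zero.\<close>

lemma spin_coeff_sum:
  assumes "i \<le> N"
  shows "(\<Sum>l\<le>N. spin_coeff N a i l * f l) =
    (if a = 1 then ((of_nat N - of_nat i) * f (i + 1) + of_nat i * f (i - 1)) / 2
     else if a = 2 then - (\<i> / 2) * ((of_nat N - of_nat i) * f (i + 1) - of_nat i * f (i - 1))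
     else (of_nat N / 2 - of_nat i) * f i)"
proof -
  have plus: "(\<Sum>l\<le>N. (if l = i + 1 then of_nat N - of_nat i else 0) * f l) = (of_nat N - of_nat i) * f (i + 1)"
    using assms by (cases "i = N") (auto simp: if_distrib[of "\<lambda>x. x * _"] cong: if_cong)
  have minus: "(\<Sum>l\<le>N. (if i = l + 1 then of_nat i else 0) * f l) = of_nat i * f (i - 1)"
    using assms by (cases i) (auto simp: if_distrib[of "\<lambda>x. x * _"] cong: if_cong)
  have z: "(\<Sum>l\<le>N. (if i = l then of_nat N / 2 - of_nat i else 0) * f l) = (of_nat N / 2 - of_nat i) * f i"
    using assms by (auto simp: if_distrib[of "\<lambda>x. x * _"] cong: if_cong)
  consider "a = 1" | "a = 2" | "a = 3" using exhaust_3 by blast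
  then show ?thesis
  proof cases
    case 1
    have "(\<Sum>l\<le>N. spin_coeff N a i l * f l) = ((\<Sum>l\<le>N. (if l = i + 1 then of_nat N - of_nat i else 0) * f l)
        + (\<Sum>l\<le>N. (if i = l + 1 then of_nat i else 0) * f l)) / 2"
      unfolding sum.distrib[symmetric] sum_divide_distrib
      by (intro sum.cong refl) (simp add: 1 spin_coeff_def)
    then show ?thesis using 1 plus minus by simp
  next
    case 2
    have "(\<Sum>l\<le>N. spin_coeff N a i l * f l) = - (\<i> / 2)
        * ((\<Sum>l\<le>N. (if l = i + 1 then of_nat N - of_nat i else 0) * f l)
        - (\<Sum>l\<le>N. (if i = l + 1 then of_nat i else 0) * f l))"
      unfolding sum_subtractf[symmetric] sum_distrib_left
      by (intro sum.cong refl) (simp add: 2 spin_coeff_def algebra_simps)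
    then show ?thesis using 2 plus minus by simp
  next
    case 3
    then have "spin_coeff N a i l = (if i = l then of_nat N / 2 - of_nat i else 0)" for l
      by (simp add: spin_coeff_def)
    then show ?thesis using 3 z by simp
  qed
qed

lemma spin_op_mult_index:
  assumes "i \<le> N" "j \<le> N"
  shows "(spin_op N a * spin_op N b) $$ (i, j)
    = binomial_weight N i j * (\<Sum>l\<le>N. spin_coeff N a i l * spin_coeff N b l j)"
proof -
  have "(spin_op N a * spin_op N b) $$ (i, j) = (\<Sum>l\<le>N. spin_op N a $$ (i, l) * spin_op N b $$ (l, j))"
    using assms spin_op_carrier[of N a] spin_op_carrier[of N b]
    by (simp add: times_mat_def scalar_prod_def atLeast0LessThan lessThan_Suc_atMost)
  also have "\<dots> = (\<Sum>l\<le>N. (binomial_weight N i l * binomial_weight N l j) * (spin_coeff N a i l * spin_coeff N b l j))"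
    using assms by (intro sum.cong refl) (simp add: spin_op_index mult_ac)
  finally show ?thesis
    by (simp add: binomial_weight_mult sum_distrib_left)
qed

section \<open>Averages against the coherent-state measurement\<close>

text \<open>The bound on \<open>t\<close> covers degree \<open>N\<close> from the projector entries
  and two further degrees from a product of coordinates.\<close>

locale coherent_design =
  fixes N t M :: nat and n :: "nat \<Rightarrow> real ^ 3" and R :: "real ^ 3 \<Rightarrow> complex mat"
  assumes design: "spherical_design t M n"
    and frame: "\<And>p. p \<in> sphere 0 1 \<Longrightarrow> lifts_pole_to p (R p)"
    and degree: "N + 2 \<le> t"
begin

text \<open>The coordinates and the entries of the POVM are both combinations of such monomials, so
  products only add exponents.\<close>

definition spinor_mono :: "nat \<Rightarrow> nat \<Rightarrow> nat \<Rightarrow> nat \<Rightarrow> nat \<Rightarrow> complex" where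
  "spinor_mono a b c d k = R (n k) $$ (0, 0) ^ a * cnj (R (n k) $$ (0, 0)) ^ b
     * R (n k) $$ (1, 0) ^ c * cnj (R (n k) $$ (1, 0)) ^ d"

text \<open>An entry of the operator whose expectation in a state is the mean of \<open>f\<close>
  under the outcome law.\<close>

definition povm_sum :: "nat \<Rightarrow> nat \<Rightarrow> (nat \<Rightarrow> complex) \<Rightarrow> complex" where
  "povm_sum i j f = (\<Sum>k = 1..M. povm N R M n k $$ (i, j) * f k)"

lemma povm_sum_linear:
  "povm_sum i j (\<lambda>k. f k + g k) = povm_sum i j f + povm_sum i j g"
  "povm_sum i j (\<lambda>k. f k - g k) = povm_sum i j f - povm_sum i j g"
  "povm_sum i j (\<lambda>k. c * f k) = c * povm_sum i j f"
  by (simp_all add: povm_sum_def distrib_left right_diff_distrib sum.distrib sum_subtractf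
      sum_distrib_left mult.left_commute)

lemma spinor_mono_mult:
  "spinor_mono a b c d k * spinor_mono a' b' c' d' k = spinor_mono (a + a') (b + b') (c + c') (d + d') k"
  by (simp add: spinor_mono_def power_add mult_ac)

text \<open>The POVM entry adds \<open>N - i\<close>, \<open>N - j\<close>, \<open>i\<close>,
  \<open>j\<close> to the exponents and \<open>design_moment\<close> evaluates the sum. The
  denominator is moved to the left so that the right side stays polynomial in \<open>i\<close> and
  \<open>N\<close>.\<close>

lemma povm_sum_mono:
  assumes i: "i \<le> N" and j: "j \<le> N" and eq: "a + c = b + d" and deg: "a + c \<le> 2"
  shows "fact (Suc (N + (a + c))) * povm_sum i j (spinor_mono a b c d) = binomial_weight N i j *
    (if a + j = b + i then
       fact (Suc N) * ffact b (of_nat N - of_nat i + of_nat a) * ffact d (of_nat i + of_nat c)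
     else 0)"
proof -
  define ci cj where "ci = complex_of_real (sqrt (real (N choose i)))"
    and "cj = complex_of_real (sqrt (real (N choose j)))"
  have M: "(of_nat M :: complex) \<noteq> 0" and sph: "\<And>k. k \<in> {1..M} \<Longrightarrow> n k \<in> sphere 0 1"
    using design by (auto simp: spherical_design_def)
  have cj: "cj \<noteq> 0" "cj * cj = of_nat (N choose j)"
    using j by (simp_all add: cj_def flip: of_real_mult)
  have "povm_sum i j (spinor_mono a b c d) = (\<Sum>k = 1..M. of_nat (N + 1) / of_nat M * ci * cj *
      (R (n k) $$ (0, 0) ^ (N - i + a) * cnj (R (n k) $$ (0, 0)) ^ (N - j + b)
      * R (n k) $$ (1, 0) ^ (i + c) * cnj (R (n k) $$ (1, 0)) ^ (j + d)))"
    unfolding povm_sum_def povm_index[OF i j] ci_def cj_def spinor_mono_def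
    by (intro sum.cong refl) (simp add: power_add mult_ac)
  also have "\<dots> = of_nat (N + 1) / of_nat M * ci * cj *
      (if N - i + a = N - j + b then of_nat M * fact (N - i + a) * fact (i + c)
        / fact (Suc (N - i + a + (i + c))) else 0)"
    unfolding sum_distrib_left[symmetric]
    by (subst design_moment[OF design]) (use i j eq deg degree lifts_pole_to_entries[OF frame[OF sph]] in auto)
  also have "\<dots> = of_nat (N + 1) * ci * cj * (if a + j = b + i then fact (N - i + a) * fact (i + c)
        / fact (Suc (N + (a + c))) else 0)"
  proof -
    have "N - i + a = N - j + b \<longleftrightarrow> a + j = b + i" using i j by auto
    moreover have "N - i + a + (i + c) = N + (a + c)" using i by simp
    ultimately show ?thesis using M by simp
  qed
  also have "fact (Suc (N + (a + c))) * \<dots> = of_nat (N + 1) * ci * cj *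
      (if a + j = b + i then fact (N - i + a) * fact (i + c) else 0)"
    by (simp del: fact_Suc)
  also have "\<dots> = ci / cj * (if a + j = b + i then
      fact (Suc N) * ffact b (of_nat N - of_nat i + of_nat a) * ffact d (of_nat i + of_nat c) else 0)"
  proof (cases "a + j = b + i")
    case True
    \<comment> \<open>These splittings leave \<open>fact (N - j)\<close> and \<open>fact j\<close>,
      which combine with the binomial \<open>cj * cj\<close> to \<open>fact N\<close>.\<close>
    have 1: "N - i + a = (N - j) + b" and 2: "i + c = j + d" using True i j eq by auto
    have f1: "(fact (N - i + a) :: complex) = ffact b (of_nat N - of_nat i + of_nat a) * fact (N - j)"
      using fact_eq_ffact_mult[of "N - j" b, where 'a = complex] i
      unfolding 1[symmetric] by (simp add: of_nat_diff algebra_simps)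
    have f2: "(fact (i + c) :: complex) = ffact d (of_nat i + of_nat c) * fact j"
      using fact_eq_ffact_mult[of j d, where 'a = complex] unfolding 2[symmetric] by simp
    have "fact j * fact (N - j) * (N choose j) = fact N" using j by (rule binomial_fact_lemma)
    then have "(fact j * fact (N - j) * (cj * cj) :: complex) = fact N"
      unfolding cj by (metis of_nat_fact of_nat_mult)
    then have "fact (Suc N) = of_nat (N + 1) * (fact j * fact (N - j) * (cj * cj) :: complex)"
      by simp
    moreover have "of_nat (N + 1) * ci * cj * (x * fact (N - j) * (y * fact j))
        = ci / cj * (of_nat (N + 1) * (fact j * fact (N - j) * (cj * cj)) * x * y)" for x y
      using cj(1) by simp
    ultimately show ?thesis using True by (simp only: f1 f2 if_True simp_thms)
  qed simp
  finally show ?thesis by (simp add: binomial_weight_def ci_def cj_def)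
qed

text \<open>The resolution of the identity: the POVM elements sum to the unit matrix.\<close>

lemma povm_sum_mono_0:
  assumes "i \<le> N" "j \<le> N"
  shows "povm_sum i j (spinor_mono 0 0 0 0) = binomial_weight N i j * (if i = j then 1 else 0)"
  using povm_sum_mono[OF assms, of 0 0 0 0] by (auto simp del: fact_Suc)

text \<open>Cancelling (N + 1)! leaves the factor N + 2, and in second degree (N + 2) (N +
  3).\<close>

lemma povm_sum_mono_1:
  assumes "i \<le> N" "j \<le> N" "a + c = b + d" "a + c = 1"
  shows "(of_nat N + 2) * povm_sum i j (spinor_mono a b c d) = binomial_weight N i j *
    (if a + j = b + i then ffact b (of_nat N - of_nat i + of_nat a) * ffact d (of_nat i + of_nat c) else 0)"
proof -
  have "(fact (Suc (N + (a + c))) :: complex) = fact (Suc N) * (of_nat N + 2)"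
    unfolding assms(4) by (simp add: algebra_simps)
  with povm_sum_mono[OF assms(1-3)] assms(4) show ?thesis by (auto simp: mult_ac simp del: fact_Suc)
qed

lemma povm_sum_mono_2:
  assumes "i \<le> N" "j \<le> N" "a + c = b + d" "a + c = 2"
  shows "(of_nat N + 2) * (of_nat N + 3) * povm_sum i j (spinor_mono a b c d) = binomial_weight N i j *
    (if a + j = b + i then ffact b (of_nat N - of_nat i + of_nat a) * ffact d (of_nat i + of_nat c) else 0)"
proof -
  have "(fact (Suc (N + (a + c))) :: complex) = fact (Suc N) * ((of_nat N + 2) * (of_nat N + 3))"
    unfolding assms(4) by (simp add: numeral_2_eq_2 algebra_simps)
  with povm_sum_mono[OF assms(1-3)] assms(4) show ?thesis by (auto simp: mult_ac simp del: fact_Suc)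
qed

text \<open>The mixed monomials are (x + i y) / 2 and its conjugate, the diagonal ones are u and v,
  and u - v = z.\<close>

lemma coord_eq_spinor_mono:
  assumes "k \<in> {1..M}"
  shows "of_real (n k $ 1) = spinor_mono 0 1 1 0 k + spinor_mono 1 0 0 1 k"
    and "of_real (n k $ 2) = - \<i> * (spinor_mono 0 1 1 0 k - spinor_mono 1 0 0 1 k)"
    and "of_real (n k $ 3) = spinor_mono 1 1 0 0 k - spinor_mono 0 0 1 1 k"
proof -
  have "n k \<in> sphere 0 1" using design assms by (simp add: spherical_design_def)
  note e = lifts_pole_to_entries[OF frame[OF this]]
  have w: "spinor_mono 0 1 1 0 k = Complex (n k $ 1) (n k $ 2) / 2"
    using e(3) by (simp add: spinor_mono_def)
  have w': "spinor_mono 1 0 0 1 k = cnj (Complex (n k $ 1) (n k $ 2) / 2)"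
    using e(3)[symmetric] by (simp add: spinor_mono_def)
  show "of_real (n k $ 1) = spinor_mono 0 1 1 0 k + spinor_mono 1 0 0 1 k"
    "of_real (n k $ 2) = - \<i> * (spinor_mono 0 1 1 0 k - spinor_mono 1 0 0 1 k)"
    unfolding w w' by (simp_all add: complex_eq_iff)
  have "spinor_mono 1 1 0 0 k = of_real ((1 + n k $ 3) / 2)" "spinor_mono 0 0 1 1 k = of_real ((1 - n k $ 3) / 2)"
    using e(1,2) by (simp_all add: spinor_mono_def)
  then show "of_real (n k $ 3) = spinor_mono 1 1 0 0 k - spinor_mono 0 0 1 1 k"
    by (simp only: of_real_diff[symmetric]) (simp add: field_simps)
qed

lemma povm_sum_cong:
  "(\<And>k. k \<in> {1..M} \<Longrightarrow> f k = g k) \<Longrightarrow> povm_sum i j f = povm_sum i j g"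
  by (simp add: povm_sum_def)

lemma povm_sum_coord:
  assumes "i \<le> N" "j \<le> N"
  shows "(of_nat N / 2 + 1) * povm_sum i j (\<lambda>k. of_real (n k $ a)) = spin_op N a $$ (i, j)"
proof -
  note m = povm_sum_mono_1[OF assms]
  define w where "w = binomial_weight N i j"
  have up: "(of_nat N + 2) * povm_sum i j (spinor_mono 0 1 1 0) = w * (if j = i + 1 then of_nat N - of_nat i else 0)"
    and down: "(of_nat N + 2) * povm_sum i j (spinor_mono 1 0 0 1) = w * (if i = j + 1 then of_nat i else 0)"
    and top: "(of_nat N + 2) * povm_sum i j (spinor_mono 1 1 0 0) = w * (if i = j then of_nat N - of_nat i + 1 else 0)"
    and bot: "(of_nat N + 2) * povm_sum i j (spinor_mono 0 0 1 1) = w * (if i = j then of_nat i + 1 else 0)"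
    \<comment> \<open>Instantiation follows the order \<open>a\<close>, \<open>c\<close>,
      \<open>b\<close>, \<open>d\<close> in which the variables first occur in the
      hypotheses.\<close>
    using m[of 0 1 1 0] m[of 1 0 0 1] m[of 1 0 1 0] m[of 0 1 0 1] by (auto simp: w_def)
  have "(of_nat N + 2) * povm_sum i j (\<lambda>k. of_real (n k $ a)) = 2 * (w * spin_coeff N a i j)"
    (is "?K * _ = _")
  proof -
    consider "a = 1" | "a = 2" | "a = 3" using exhaust_3 by blast
    then show ?thesis
    proof cases
      case 1
      have "?K * povm_sum i j (\<lambda>k. of_real (n k $ a))
          = ?K * povm_sum i j (spinor_mono 0 1 1 0) + ?K * povm_sum i j (spinor_mono 1 0 0 1)"
        unfolding 1 distrib_left[symmetric] povm_sum_linear[symmetric]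
        by (intro arg_cong[of _ _ "\<lambda>x. ?K * x"] povm_sum_cong coord_eq_spinor_mono)
      also have "\<dots> = 2 * (w * spin_coeff N a i j)"
        unfolding up down by (simp add: 1 spin_coeff_def algebra_simps)
      finally show ?thesis .
    next
      case 2
      have "?K * povm_sum i j (\<lambda>k. of_real (n k $ a))
          = ?K * (- \<i> * (povm_sum i j (spinor_mono 0 1 1 0) - povm_sum i j (spinor_mono 1 0 0 1)))"
        unfolding 2 povm_sum_linear[symmetric]
        by (intro arg_cong[of _ _ "\<lambda>x. ?K * x"] povm_sum_cong coord_eq_spinor_mono)
      also have "\<dots> = - \<i> * (?K * povm_sum i j (spinor_mono 0 1 1 0) - ?K * povm_sum i j (spinor_mono 1 0 0 1))"
        by (simp add: algebra_simps)
      also have "\<dots> = 2 * (w * spin_coeff N a i j)"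
        unfolding up down by (simp add: 2 spin_coeff_def algebra_simps)
      finally show ?thesis .
    next
      case 3
      have "?K * povm_sum i j (\<lambda>k. of_real (n k $ a))
          = ?K * povm_sum i j (spinor_mono 1 1 0 0) - ?K * povm_sum i j (spinor_mono 0 0 1 1)"
        unfolding 3 right_diff_distrib[symmetric] povm_sum_linear[symmetric]
        by (intro arg_cong[of _ _ "\<lambda>x. ?K * x"] povm_sum_cong coord_eq_spinor_mono)
      also have "\<dots> = 2 * (w * spin_coeff N a i j)"
        unfolding top bot by (simp add: 3 spin_coeff_def algebra_simps)
      finally show ?thesis .
    qed
  qed
  then show ?thesis unfolding spin_op_index[OF assms] w_def by (simp add: field_simps)
qed


text \<open>Up to scale, averaging a product of coordinates gives the anticommutator plus, for
  \<open>a = b\<close>, a multiple of the identity; the constant in \<open>obs_Y\<close> removes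
  that multiple.\<close>

lemma povm_sum_coord_mult:
  assumes ij: "i \<le> N" "j \<le> N"
  shows "(of_nat N + 2) * (of_nat N + 3) * povm_sum i j (\<lambda>k. of_real (n k $ a) * of_real (n k $ b))
    = binomial_weight N i j * (2 * ((\<Sum>l\<le>N. spin_coeff N a i l * spin_coeff N b l j)
      + (\<Sum>l\<le>N. spin_coeff N b i l * spin_coeff N a l j)) + (if a = b \<and> i = j then of_nat N + 2 else 0))"
proof -
  define K where "K = (of_nat N + 2) * (of_nat N + 3 :: complex)"
  define w where "w = binomial_weight N i j"
  define anti where "anti a b = (\<Sum>l\<le>N. spin_coeff N a i l * spin_coeff N b l j)
      + (\<Sum>l\<le>N. spin_coeff N b i l * spin_coeff N a l j)" for a b
  note m = povm_sum_mono_2[OF ij]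
  \<comment> \<open>All monomials of second degree that occur, sorted by the offset
    \<open>j - i\<close>: zero here, then positive, then negative.\<close>
  have diag:
    "K * povm_sum i j (spinor_mono 2 2 0 0) = w * (if i = j then (of_nat N - of_nat i + 2) * (of_nat N - of_nat i + 1) else 0)"
    "K * povm_sum i j (spinor_mono 1 1 1 1) = w * (if i = j then (of_nat N - of_nat i + 1) * (of_nat i + 1) else 0)"
    "K * povm_sum i j (spinor_mono 0 0 2 2) = w * (if i = j then (of_nat i + 2) * (of_nat i + 1) else 0)"
    using m[of 2 0 2 0] m[of 1 1 1 1] m[of 0 2 0 2] by (auto simp: w_def K_def)
  have up:
    "K * povm_sum i j (spinor_mono 1 2 1 0) = w * (if j = i + 1 then (of_nat N - of_nat i + 1) * (of_nat N - of_nat i) else 0)"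
    "K * povm_sum i j (spinor_mono 0 1 2 1) = w * (if j = i + 1 then (of_nat N - of_nat i) * (of_nat i + 2) else 0)"
    "K * povm_sum i j (spinor_mono 0 2 2 0) = w * (if j = i + 2 then (of_nat N - of_nat i) * (of_nat N - of_nat i - 1) else 0)"
    using m[of 1 1 2 0] m[of 0 2 1 1] m[of 0 2 2 0] by (auto simp: w_def K_def)
  have down:
    "K * povm_sum i j (spinor_mono 2 1 0 1) = w * (if i = j + 1 then (of_nat N - of_nat i + 2) * of_nat i else 0)"
    "K * povm_sum i j (spinor_mono 1 0 1 2) = w * (if i = j + 1 then (of_nat i + 1) * of_nat i else 0)"
    "K * povm_sum i j (spinor_mono 2 0 0 2) = w * (if i = j + 2 then of_nat i * (of_nat i - 1) else 0)"
    using m[of 2 0 1 1] m[of 1 1 0 2] m[of 2 0 0 2] by (auto simp: w_def K_def)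
  note table = diag up down
  define L where "L f = K * povm_sum i j f" for f
  have lin: "L (\<lambda>k. f k + g k) = L f + L g" "L (\<lambda>k. f k - g k) = L f - L g" "L (\<lambda>k. c * f k) = c * L f"
    for f g c
    by (simp_all only: L_def povm_sum_linear distrib_left right_diff_distrib mult.left_commute)
  define claim where "claim a b \<longleftrightarrow> L (\<lambda>k. of_real (n k $ a) * of_real (n k $ b))
      = w * (2 * anti a b + (if a = b \<and> i = j then of_nat N + 2 else 0))" for a b
  have claimI: "claim a b" if "\<And>k. k \<in> {1..M} \<Longrightarrow> of_real (n k $ a) * of_real (n k $ b) = h k"
    and "L h = w * (2 * anti a b + (if a = b \<and> i = j then of_nat N + 2 else 0))" for a b h
    unfolding claim_def that(2)[symmetric] L_def
    using that(1) by (intro arg_cong[of _ _ "\<lambda>x. K * x"] povm_sum_cong)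
  \<comment> \<open>Symmetry in the two directions leaves six cases, each with \<open>h\<close> the
    expansion of the product of coordinates; splitting on \<open>i\<close> resolves the truncated
    \<open>i - 1\<close> from \<open>spin_coeff_sum\<close>.\<close>
  have sym: "claim b a" if "claim a b" for a b
    using that by (simp add: claim_def anti_def mult.commute add.commute eq_commute[of a b])
  note coord = coord_eq_spinor_mono spinor_mono_mult algebra_simps numeral_2_eq_2
  note table' = lin table[folded L_def] anti_def spin_coeff_sum[OF ij(1)]
  have "claim 1 1"
    by (rule claimI[where h = "\<lambda>k. spinor_mono 0 2 2 0 k + 2 * spinor_mono 1 1 1 1 k + spinor_mono 2 0 0 2 k"], simp add: coord)
      (unfold table', cases i, auto simp: spin_coeff_def field_simps)
  moreover have "claim 2 2"
    by (rule claimI[where h = "\<lambda>k. 2 * spinor_mono 1 1 1 1 k - spinor_mono 0 2 2 0 k - spinor_mono 2 0 0 2 k"], simp add: coord)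
      (unfold table', cases i, auto simp: spin_coeff_def field_simps)
  moreover have "claim 3 3"
    by (rule claimI[where h = "\<lambda>k. spinor_mono 2 2 0 0 k - 2 * spinor_mono 1 1 1 1 k + spinor_mono 0 0 2 2 k"], simp add: coord)
      (unfold table', cases i, auto simp: spin_coeff_def field_simps)
  moreover have "claim 1 2"
    by (rule claimI[where h = "\<lambda>k. - \<i> * (spinor_mono 0 2 2 0 k - spinor_mono 2 0 0 2 k)"], simp add: coord)
      (unfold table', cases i, auto simp: spin_coeff_def field_simps)
  moreover have "claim 1 3"
    by (rule claimI[where h = "\<lambda>k. (spinor_mono 1 2 1 0 k - spinor_mono 0 1 2 1 k) + (spinor_mono 2 1 0 1 k - spinor_mono 1 0 1 2 k)"], simp add: coord)
      (unfold table', cases i, auto simp: spin_coeff_def field_simps)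
  moreover have "claim 2 3"
    by (rule claimI[where h = "\<lambda>k. - \<i> * ((spinor_mono 1 2 1 0 k - spinor_mono 0 1 2 1 k) - (spinor_mono 2 1 0 1 k - spinor_mono 1 0 1 2 k))"], simp add: coord)
      (unfold table', cases i, auto simp: spin_coeff_def field_simps)
  ultimately have "claim a b"
    using sym exhaust_3[of a] exhaust_3[of b] by metis
  then show ?thesis by (simp add: claim_def L_def K_def w_def anti_def)
qed


section \<open>Operators represented by the observables\<close>

lemma povm_sum_obs_X:
  assumes "2 * J = real N" "i \<le> N" "j \<le> N"
  shows "povm_sum i j (\<lambda>k. of_real (obs_X J n a k)) = spin_op N a $$ (i, j)"
proof -
  have "complex_of_real (J + 1) = of_nat N / 2 + 1"
    using assms(1) by (simp add: complex_eq_iff)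
  then have "(\<lambda>k. complex_of_real (obs_X J n a k)) = (\<lambda>k. (of_nat N / 2 + 1) * of_real (n k $ a))"
    by (simp only: obs_X_def of_real_mult)
  then show ?thesis by (simp only: povm_sum_linear povm_sum_coord[OF assms(2,3)])
qed

lemma povm_sum_obs_Y:
  assumes J: "2 * J = real N" and ij: "i \<le> N" "j \<le> N"
  shows "povm_sum i j (\<lambda>k. of_real (obs_Y J n a b k))
    = ((1 / 2) \<cdot>\<^sub>m (spin_op N a * spin_op N b + spin_op N b * spin_op N a)) $$ (i, j)"
proof -
  let ?K = "(of_nat N + 2) * (of_nat N + 3) :: complex" and ?c = "(of_nat N + 2) / 4 * (if a = b then 1 else 0) :: complex"
  have "obs_Y J n a b k = (real N + 2) * (real N + 3) / 4 * (n k $ a * n k $ b)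
      - (real N + 2) / 4 * (if a = b then 1 else 0)" for k
    unfolding J[symmetric] obs_Y_def by (simp add: field_simps)
  \<comment> \<open>The constant is written as a multiple of the trivial monomial so that the
    resolution of the identity applies to it.\<close>
  then have "complex_of_real (obs_Y J n a b k)
      = ?K / 4 * (of_real (n k $ a) * of_real (n k $ b)) - ?c * spinor_mono 0 0 0 0 k" for k
    by (simp add: spinor_mono_def)
  then have "povm_sum i j (\<lambda>k. of_real (obs_Y J n a b k))
      = ?K / 4 * povm_sum i j (\<lambda>k. of_real (n k $ a) * of_real (n k $ b))
        - ?c * povm_sum i j (spinor_mono 0 0 0 0)"
    by (simp only: povm_sum_linear)
  also have "\<dots> = (?K * povm_sum i j (\<lambda>k. of_real (n k $ a) * of_real (n k $ b))) / 4
        - ?c * povm_sum i j (spinor_mono 0 0 0 0)"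
    by simp
  also have "\<dots> = 1 / 2 * ((spin_op N a * spin_op N b) $$ (i, j) + (spin_op N b * spin_op N a) $$ (i, j))"
    unfolding povm_sum_coord_mult[OF ij] povm_sum_mono_0[OF ij] spin_op_mult_index[OF ij]
    by (simp add: algebra_simps)
  also have "\<dots> = ((1 / 2) \<cdot>\<^sub>m (spin_op N a * spin_op N b + spin_op N b * spin_op N a)) $$ (i, j)"
    using ij spin_op_carrier[of N a] spin_op_carrier[of N b] by simp
  finally show ?thesis .
qed

text \<open>Passes from entrywise identities to expectation values: the trace is expanded and the
  sum over outcomes moved innermost.\<close>

lemma sum_trace_povm:
  assumes \<rho>: "\<rho> \<in> carrier_mat (N + 1) (N + 1)" and A: "A \<in> carrier_mat (N + 1) (N + 1)"
    and f: "\<And>i j. i \<le> N \<Longrightarrow> j \<le> N \<Longrightarrow> povm_sum i j f = A $$ (i, j)"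
  shows "(\<Sum>k = 1..M. f k * mat_trace (\<rho> * povm N R M n k)) = mat_trace (\<rho> * A)"
proof -
  have tr: "mat_trace (\<rho> * B) = (\<Sum>i\<le>N. \<Sum>l\<le>N. \<rho> $$ (i, l) * B $$ (l, i))"
    if "B \<in> carrier_mat (N + 1) (N + 1)" for B
    using \<rho> that by (simp add: mat_trace_def times_mat_def scalar_prod_def atLeast0LessThan lessThan_Suc_atMost)
  have "povm N R M n k \<in> carrier_mat (N + 1) (N + 1)" for k
    by (simp add: povm_def coherent_projector_def rank_one_def coherent_state_def spin_rep_def)
  then have "(\<Sum>k = 1..M. f k * mat_trace (\<rho> * povm N R M n k))
      = (\<Sum>k = 1..M. \<Sum>i\<le>N. \<Sum>l\<le>N. \<rho> $$ (i, l) * (povm N R M n k $$ (l, i) * f k))"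
    by (simp add: tr sum_distrib_left mult_ac)
  also have "\<dots> = (\<Sum>i\<le>N. \<Sum>l\<le>N. \<rho> $$ (i, l) * povm_sum l i f)"
    unfolding povm_sum_def sum_distrib_left
    by (rule trans[OF sum.swap], rule sum.cong[OF refl], rule sum.swap)
  also have "\<dots> = mat_trace (\<rho> * A)" using f by (simp add: tr[OF A])
  finally show ?thesis .
qed

end

section \<open>Expectation of the estimator\<close>

context prob_space
begin

lemma borel_measurable_finite_valued:
  assumes "random_variable (count_space A) X"
  shows "(\<lambda>w. f (X w) :: real) \<in> borel_measurable M"
  using measurable_compose[OF assms, of f borel] by simp

lemma integrable_finite_valued:
  assumes "finite A" and X: "random_variable (count_space A) X"
  shows "integrable M (\<lambda>w. f (X w) :: real)"
proof (rule integrable_const_bound[of _ "\<Sum>k\<in>A. \<bar>f k\<bar>"])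
  show "AE w in M. norm (f (X w)) \<le> (\<Sum>k\<in>A. \<bar>f k\<bar>)"
  proof (rule AE_I2)
    fix w assume "w \<in> space M"
    then have "X w \<in> A" using measurable_space[OF X] by simp
    then show "norm (f (X w)) \<le> (\<Sum>k\<in>A. \<bar>f k\<bar>)"
      using member_le_sum[of "X w" A "\<lambda>k. \<bar>f k\<bar>"] assms(1) by simp
  qed
qed (rule borel_measurable_finite_valued[OF X])

lemma expectation_finite_valued:
  assumes "finite A" and X: "random_variable (count_space A) X"
  shows "expectation (\<lambda>w. f (X w)) = (\<Sum>k\<in>A. f k * prob {w \<in> space M. X w = k})"
proof -
  have ev: "{w \<in> space M. X w = k} \<in> events" if "k \<in> A" for k
    using measurable_sets[OF X, of "{k}"] that by (simp add: vimage_def Int_def conj_commute)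
  have "expectation (\<lambda>w. f (X w)) = expectation (\<lambda>w. \<Sum>k\<in>A. f k * indicator {w \<in> space M. X w = k} w)"
  proof (rule Bochner_Integration.integral_cong)
    fix w assume w: "w \<in> space M"
    then have "X w \<in> A" using measurable_space[OF X] by simp
    have "(\<Sum>k\<in>A. f k * indicator {w \<in> space M. X w = k} w) = (\<Sum>k\<in>A. if k = X w then f k else 0)"
      using w by (intro sum.cong refl) (auto simp: indicator_def)
    then show "f (X w) = (\<Sum>k\<in>A. f k * indicator {w \<in> space M. X w = k} w)"
      using \<open>X w \<in> A\<close> assms(1) by simp
  qed simp
  also have "\<dots> = (\<Sum>k\<in>A. f k * prob {w \<in> space M. X w = k})"
    using ev by (subst Bochner_Integration.integral_sum) (auto simp: emeasure_eq_measure)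
  finally show ?thesis .
qed

lemma indep_finite_valued_mult:
  fixes f g :: "'b \<Rightarrow> real"
  assumes "finite A" and ind: "indep_vars (\<lambda>_. count_space A) X I" and ij: "i \<in> I" "j \<in> I" "i \<noteq> j"
  shows "expectation (\<lambda>w. f (X i w) * g (X j w)) = expectation (\<lambda>w. f (X i w)) * expectation (\<lambda>w. g (X j w))"
    and "integrable M (\<lambda>w. f (X i w) * g (X j w))"
proof -
  \<comment> \<open>One indexed family carrying \<open>f\<close> at \<open>i\<close> and
    \<open>g\<close> at \<open>j\<close>, the form required by the product rule for independent
    variables.\<close>
  define Y where "Y l = (if l = i then f else g)" for l
  have "indep_vars (\<lambda>_. borel) (\<lambda>l w. Y l (X l w)) {i, j}"
    using ij by (intro indep_vars_compose2[OF indep_vars_subset[OF ind]]) auto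
  moreover have "integrable M (\<lambda>w. Y l (X l w))" if "l \<in> {i, j}" for l
    using ind ij that assms(1) by (intro integrable_finite_valued[of A]) (auto simp: indep_vars_def)
  ultimately show "expectation (\<lambda>w. f (X i w) * g (X j w)) = expectation (\<lambda>w. f (X i w)) * expectation (\<lambda>w. g (X j w))"
    "integrable M (\<lambda>w. f (X i w) * g (X j w))"
    using indep_vars_lebesgue_integral[of "{i, j}" "\<lambda>l w. Y l (X l w)"]
      indep_vars_integrable[of "{i, j}" "\<lambda>l w. Y l (X l w)"] ij(3)
    by (auto simp: Y_def)
qed

text \<open>The statistical half, separated from the operators: the means enter only as the numbers
  \<open>\<mu> c\<close> and \<open>\<nu>\<close>.\<close>

lemma expectation_Gamma_hat:
  assumes ind: "indep_vars (\<lambda>_. count_space {1..m}) K {1..Ns}" and Ns: "Ns > 1"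
    and X: "\<And>i c. i \<in> {1..Ns} \<Longrightarrow> expectation (\<lambda>w. obs_X J n c (K i w)) = \<mu> c"
    and Y: "\<And>i. i \<in> {1..Ns} \<Longrightarrow> expectation (\<lambda>w. obs_Y J n a b (K i w)) = \<nu>"
  shows "expectation (\<lambda>w. Gamma_hat J n Ns a b (\<lambda>i. K i w)) = \<nu> - \<mu> a * \<mu> b"
proof -
  let ?X = "\<lambda>c i w. obs_X J n c (K i w)" and ?Y = "\<lambda>i w. obs_Y J n a b (K i w)"
  have K: "random_variable (count_space {1..m}) (K i)" if "i \<in> {1..Ns}" for i
    using ind that by (simp add: indep_vars_def)
  have G: "Gamma_hat J n Ns a b (\<lambda>i. K i w) = (\<Sum>i = 1..Ns. ?Y i w) / real Ns
      - (\<Sum>i = 1..Ns. \<Sum>j \<in> {1..Ns} - {i}. ?X a i w * ?X b j w) / (real Ns * (real Ns - 1))" for w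
  proof -
    have "(\<Sum>j \<in> {1..Ns} - {i}. ?X a i w * ?X b j w) = ?X a i w * (\<Sum>j = 1..Ns. ?X b j w) - ?X a i w * ?X b i w"
      if "i \<in> {1..Ns}" for i
      using that by (simp add: sum_diff1 sum_distrib_left)
    then have "(\<Sum>i = 1..Ns. \<Sum>j \<in> {1..Ns} - {i}. ?X a i w * ?X b j w)
        = (\<Sum>i = 1..Ns. ?X a i w) * (\<Sum>j = 1..Ns. ?X b j w) - (\<Sum>i = 1..Ns. ?X a i w * ?X b i w)"
      by (simp add: sum_subtractf sum_distrib_right)
    moreover have "(N * (p / N) * (q / N) - r / N) / (N - 1) = (p * q - r) / (N * (N - 1))"
      if "N > 1" for N p q r :: real
      using that by (simp add: field_simps)
    ultimately show ?thesis
      using Ns by (simp add: Gamma_hat_def C_hat_def mu_hat_def q_hat_def)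
  qed
  have intY: "integrable M (?Y i)" if "i \<in> {1..Ns}" for i
    by (rule integrable_finite_valued[OF _ K[OF that]]) simp
  have pair: "integrable M (\<lambda>w. ?X a i w * ?X b j w)" "expectation (\<lambda>w. ?X a i w * ?X b j w) = \<mu> a * \<mu> b"
    if "i \<in> {1..Ns}" "j \<in> {1..Ns} - {i}" for i j
    using indep_finite_valued_mult[OF _ ind, of i j] X that by auto
  let ?row = "\<lambda>i w. \<Sum>j \<in> {1..Ns} - {i}. ?X a i w * ?X b j w"
  have int_row: "integrable M (?row i)" if "i \<in> {1..Ns}" for i
    by (rule Bochner_Integration.integrable_sum, rule pair(1)[OF that])
  have int_sums: "integrable M (\<lambda>w. \<Sum>i = 1..Ns. ?Y i w)" "integrable M (\<lambda>w. \<Sum>i = 1..Ns. ?row i w)"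
    by (rule Bochner_Integration.integrable_sum, erule intY,
        rule Bochner_Integration.integrable_sum, erule int_row)
  have "expectation (\<lambda>w. \<Sum>i = 1..Ns. ?Y i w) = (\<Sum>i = 1..Ns. expectation (?Y i))"
    by (rule Bochner_Integration.integral_sum, erule intY)
  also have "\<dots> = real Ns * \<nu>" using Y by simp
  finally have "expectation (\<lambda>w. \<Sum>i = 1..Ns. ?Y i w) = real Ns * \<nu>" .
  moreover have "expectation (\<lambda>w. \<Sum>i = 1..Ns. ?row i w) = (\<Sum>i = 1..Ns. \<Sum>j \<in> {1..Ns} - {i}. \<mu> a * \<mu> b)"
  proof -
    have "expectation (\<lambda>w. \<Sum>i = 1..Ns. ?row i w) = (\<Sum>i = 1..Ns. expectation (?row i))"
      by (rule Bochner_Integration.integral_sum, erule int_row)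
    also have "\<dots> = (\<Sum>i = 1..Ns. \<Sum>j \<in> {1..Ns} - {i}. expectation (\<lambda>w. ?X a i w * ?X b j w))"
      by (intro sum.cong[OF refl] Bochner_Integration.integral_sum pair(1))
    also have "\<dots> = (\<Sum>i = 1..Ns. \<Sum>j \<in> {1..Ns} - {i}. \<mu> a * \<mu> b)"
      by (intro sum.cong[OF refl] pair(2))
    finally show ?thesis .
  qed
  \<comment> \<open>There are \<open>Ns * (Ns - 1)\<close> ordered pairs of distinct samples,
    matching the denominator in \<open>G\<close>.\<close>
  moreover have "\<dots> = real Ns * (real Ns - 1) * (\<mu> a * \<mu> b)"
    using Ns by (simp add: of_nat_diff)
  moreover have "expectation (\<lambda>w. Gamma_hat J n Ns a b (\<lambda>i. K i w))
      = expectation (\<lambda>w. \<Sum>i = 1..Ns. ?Y i w) / real Ns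
      - expectation (\<lambda>w. \<Sum>i = 1..Ns. ?row i w) / (real Ns * (real Ns - 1))"
    unfolding G
    using Bochner_Integration.integral_diff[OF integrable_divide[OF int_sums(1), of "real Ns"]
        integrable_divide[OF int_sums(2), of "real Ns * (real Ns - 1)"]]
    by (simp only: integral_divide_zero)
  ultimately show ?thesis using Ns by simp
qed

end

theorem proposition6:
  fixes J :: real and N t M Ns :: nat
    and n :: "nat \<Rightarrow> real ^ 3"
    and R :: "real ^ 3 \<Rightarrow> complex mat"
    and \<rho> :: "complex mat"
    and S :: "'w measure" and K :: "nat \<Rightarrow> 'w \<Rightarrow> nat"
    and a b :: 3
  assumes spin: "2 * J = real N"
    and design: "spherical_design t M n"
    and frame: "\<And>p. p \<in> sphere 0 1 \<Longrightarrow> lifts_pole_to p (R p)"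
    and state: "density_operator (N + 1) \<rho>"
    and prob: "prob_space S"
    and indep: "prob_space.indep_vars S (\<lambda>_. count_space {1..M}) K {1..Ns}"
    and outcome_law: "\<And>i k. i \<in> {1..Ns} \<Longrightarrow> k \<in> {1..M} \<Longrightarrow>
        complex_of_real (measure S {w \<in> space S. K i w = k}) = mat_trace (\<rho> * povm N R M n k)"
    and degree: "real t \<ge> 2 * J + 2"
    and samples: "Ns > 1"
  shows "complex_of_real (prob_space.expectation S (\<lambda>w. Gamma_hat J n Ns a b (\<lambda>i. K i w)))
           = spin_covariance N \<rho> a b"
proof -
  interpret prob_space S by (rule prob)
  interpret coherent_design N t M n R
    by unfold_locales (use design frame degree spin in auto)
  have \<rho>: "\<rho> \<in> carrier_mat (N + 1) (N + 1)" using state by (simp add: density_operator_def)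
  have mean: "complex_of_real (expectation (\<lambda>w. f (K i w))) = mat_trace (\<rho> * A)"
    if "i \<in> {1..Ns}" and A: "A \<in> carrier_mat (N + 1) (N + 1)"
      and f: "\<And>i j. i \<le> N \<Longrightarrow> j \<le> N \<Longrightarrow> povm_sum i j (\<lambda>k. of_real (f k)) = A $$ (i, j)" for i f A
  proof -
    have "random_variable (count_space {1..M}) (K i)"
      using indep that(1) by (simp add: indep_vars_def)
    then have "complex_of_real (expectation (\<lambda>w. f (K i w)))
        = (\<Sum>k = 1..M. of_real (f k) * of_real (measure S {w \<in> space S. K i w = k}))"
      by (subst expectation_finite_valued[of "{1..M}"]) auto
    also have "\<dots> = (\<Sum>k = 1..M. of_real (f k) * mat_trace (\<rho> * povm N R M n k))"
      using outcome_law[OF that(1)] by simp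
    also have "\<dots> = mat_trace (\<rho> * A)" by (rule sum_trace_povm[OF \<rho> A f])
    finally show ?thesis .
  qed
  let ?sym = "(1 / 2) \<cdot>\<^sub>m (spin_op N a * spin_op N b + spin_op N b * spin_op N a)"
  have sym: "?sym \<in> carrier_mat (N + 1) (N + 1)"
    using spin_op_carrier by (intro smult_carrier_mat add_carrier_mat mult_carrier_mat)
  have X: "complex_of_real (expectation (\<lambda>w. obs_X J n c (K i w))) = mat_trace (\<rho> * spin_op N c)"
    if "i \<in> {1..Ns}" for i c
    by (rule mean[OF that spin_op_carrier povm_sum_obs_X[OF spin]])
  have Y: "complex_of_real (expectation (\<lambda>w. obs_Y J n a b (K i w))) = mat_trace (\<rho> * ?sym)"
    if "i \<in> {1..Ns}" for i
    by (rule mean[OF that sym povm_sum_obs_Y[OF spin]])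
  have "expectation (\<lambda>w. Gamma_hat J n Ns a b (\<lambda>i. K i w))
      = Re (mat_trace (\<rho> * ?sym)) - Re (mat_trace (\<rho> * spin_op N a)) * Re (mat_trace (\<rho> * spin_op N b))"
    by (rule expectation_Gamma_hat[OF indep samples]) (simp_all flip: X Y)
  \<comment> \<open>The traces are real because they equal expectations of real observables at
    sample 1, which exists since \<open>Ns > 1\<close>.\<close>
  moreover have "mat_trace (\<rho> * A) = of_real (Re (mat_trace (\<rho> * A)))" if "A \<in> {?sym, spin_op N a, spin_op N b}" for A
    using that X[of 1] Y[of 1] samples by (metis (no_types, lifting) insert_iff singletonD Re_complex_of_real
        atLeastAtMost_iff le_refl less_imp_le_nat)
  ultimately show ?thesis
    by (simp add: spin_covariance_def)
qed

end
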